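(* Suppose $P_1$, $P_2$, and $P_3$ are pairwise disjoint and non-parallel planes in $\mathbb{H}^3$, and $B_4$ is a horoball defined by a positive light-like vector $\mathbf{x}_4$ not in the ideal boundary of any $P_i$, such that for each $i<4$, a single half-space $H_i$ bounded by $P_i$ contains $P_j$ for all $j\neq i$, $j<4$, and has $\mathbf{x}_4$ in its ideal boundary. Let $\Delta$ be the partially truncated tetrahedron determined by the $P_i$ and $B_4$. For any $i<j\in\{1,2,3\}$, with $k$ the element of $\{1,2,3\}-\{i,j\}$, let $T_1(x,y;a,b;c,d)$ be the length of the transversal of $\Delta$ joining the edge $\lambda_{ij}$ to its opposite edge $\lambda_{k4}$, where $x=\cosh\ell_{ij}$, $y=e^{h_{k4}}$, $a=\cosh\ell_{ik}$ and $b=\cosh\ell_{jk}$ are the hyperbolic cosines of the other internal edge lengths, and $c=e^{h_{i4}}$ and $d=e^{h_{j4}}$. If $a$ and $b$ are both at least $L$ and $c$ and $d$ are both at least $H$, for some fixed $L>1$ and $H\ge 1$, then \[ \cosh T_1(x,y;a,b;c,d)\ \ge\ \sqrt{\frac{2H}{y(x-1)}\left(\frac{H}{y}+2L\right)}, \] with equality if $a=b=L$ and $c=d=H$.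
   Context: Hyperboloid model. On $\mathbb{R}^{4}$ put $\mathbf{x}\circ\mathbf{y}=-x_1y_1+x_2y_2+x_3y_3+x_4y_4$. A nonzero vector $\mathbf{x}$ is light-like if $\mathbf{x}\circ\mathbf{x}=0$, and time-like if $\mathbf{x}\circ\mathbf{x}<0$; such a vector is positive if its first entry is positive. $\mathbb{H}^3$ is the set of positive $\mathbf{x}$ with $\mathbf{x}\circ\mathbf{x}=-1$, with $\cosh d_H(\mathbf{u},\mathbf{v})=-\mathbf{u}\circ\mathbf{v}$. Ideal points of $\mathbb{H}^3$ are projective classes $[\mathbf{x}]$ of positive light-like vectors. A positive light-like $\mathbf{x}$ determines the horosphere $S=\{\mathbf{v}\in\mathbb{H}^3: \mathbf{v}\circ\mathbf{x}=-1\}$ and the horoball $B=\{\mathbf{v}\in\mathbb{H}^3:\mathbf{v}\circ\mathbf{x}\ge -1\}$, with ideal point $[\mathbf{x}]$. A plane is $P=V\cap\mathbb{H}^3$ for a 3-dimensional subspace $V$ containing a time-like vector; a half-space is the closure of a component of $\mathbb{H}^3-P$. The ideal boundary of $P$ (resp. of a half-space $H$ bounded by $P$) is the intersection of the set of positive light-like vectors with $V$ (resp. with the closure of the component of $\mathbb{R}^4-V$ containing the interior of $H$). Two disjoint planes are parallel if their ideal boundaries intersect. The geodesic perpendicular to $P$ in the direction of $\mathbf{x}$ is the geodesic meeting $P$ at a right angle and having $[\mathbf{x}]$ as an ideal endpoint. The signed distance from a point to a horoball $B$ is the distance to $\partial B$, positive outside $B$ and negative inside. The signed distance $h_{i'4}$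 from the plane $P_{i'}$ to $B_4$ is the minimum over points of $P_{i'}$ of the signed distance to $B_4$. Partially truncated tetrahedron (three planes, one horoball). With $P_1,P_2,P_3,\mathbf{x}_4$ and $H_i$ as in the claim: for $i\le 3$ there is a unique plane $\widehat P_i$ meeting $P_j$ at right angles for each $j\le 3$, $j\neq i$, and having $\mathbf{x}_4$ in its ideal boundary; and there is a unique plane $\widehat P_4$ meeting $P_1,P_2,P_3$ at right angles. If $\widehat P_1$ does not meet $P_1$ orthogonally, then $\Delta=\left(\bigcap_{i=1}^3H_i\right)\cap\left(\bigcap_{i=1}^4\widehat H_i\right)$, where for $i\le 3$, $\widehat H_i$ is the half-space bounded by $\widehat P_i$ that contains the shortest arc from $P_j$ to $P_i$ for each $j\le 3$, $j\ne i$, and the geodesic ray from $P_i$, perpendicular to $P_i$, in the direction of $\mathbf{x}_4$; and $\widehat H_4$ is the half-space bounded by $\widehat P_4$ that contains the geodesics perpendicular to $P_j$ in the direction of $\mathbf{x}_4$, $j\le 3$. If $\widehat P_1$ meets $P_1$ orthogonally, then all $\widehat P_i$ equal a single plane $\widehat P$; after renumbering $P_1,P_2,P_3$ so that the perpendicular geodesic to $P_1$ and $P_3$ separates $P_2\cap\widehat P$ from $\mathbf{x}_4$, the (degenerate) $\Delta$ is $\widehat P\cap\left(\bigcap_{i=1}^3H_i\right)\cap h_{12}\cap h_{23}\cap h_{34}\cap h_{14}$, where $h_{12}$ is the half-plane of $\widehat P$ bounded by the perpendicular geodesic to $P_1$ and $P_2$ that contains $P_3\cap\widehat P$ and has $\mathbf{x}_4$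 in its ideal boundary, and the other $h$'s are defined analogously (using, for index $4$, geodesics perpendicular to $P_i$ in the direction of $\mathbf{x}_4$). Edges: for $i'\neq j'\le 3$, $\lambda_{i'j'}$ is the shortest arc joining $P_{i'}$ to $P_{j'}$, of length $\ell_{i'j'}=\ell_{j'i'}$; for $i'\le3$, $\lambda_{i'4}$ is the geodesic ray perpendicular to $P_{i'}$ (starting at $P_{i'}$) in the direction of $\mathbf{x}_4$. The transversal of $\Delta$ joining $\lambda_{ij}$ to its opposite edge $\lambda_{k4}$ is the shortest geodesic arc with one endpoint on each edge, or their point of intersection if they intersect (length $0$). This length depends only on $(x,y;a,b;c,d)$. *)

theory Defs
  imports "HOL-Analysis.Analysis"
begin

text \<open>The hyperboloid model. The topology of \<open>H3\<close> is the one induced from \<open>real^4\<close>; \<open>H3\<close> is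
  closed there, so closures of subsets of \<open>H3\<close> may be taken in \<open>real^4\<close>.\<close>

definition lorentz :: "real^4 \<Rightarrow> real^4 \<Rightarrow> real"  (infixl "\<bullet>\<^sub>L" 70) where
  "x \<bullet>\<^sub>L y = - (x $ 1 * y $ 1) + x $ 2 * y $ 2 + x $ 3 * y $ 3 + x $ 4 * y $ 4"

definition light_like :: "real^4 \<Rightarrow> bool" where
  "light_like x \<longleftrightarrow> x \<noteq> 0 \<and> x \<bullet>\<^sub>L x = 0"

definition time_like :: "real^4 \<Rightarrow> bool" where
  "time_like x \<longleftrightarrow> x \<noteq> 0 \<and> x \<bullet>\<^sub>L x < 0"

definition positive_vec :: "real^4 \<Rightarrow> bool" where
  "positive_vec x \<longleftrightarrow> x $ 1 > 0"

definition H3 :: "(real^4) set" where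
  "H3 = {x. positive_vec x \<and> x \<bullet>\<^sub>L x = -1}"

definition hdist :: "real^4 \<Rightarrow> real^4 \<Rightarrow> real" where
  "hdist u v = arcosh (- (u \<bullet>\<^sub>L v))"

definition horosphere :: "real^4 \<Rightarrow> (real^4) set" where
  "horosphere x = {v \<in> H3. v \<bullet>\<^sub>L x = -1}"

definition horoball :: "real^4 \<Rightarrow> (real^4) set" where
  "horoball x = {v \<in> H3. v \<bullet>\<^sub>L x \<ge> -1}"

definition is_plane :: "(real^4) set \<Rightarrow> bool" where
  "is_plane P \<longleftrightarrow> (\<exists>V. subspace V \<and> dim V = 3 \<and> (\<exists>x\<in>V. time_like x) \<and> P = V \<inter> H3)"

definition is_geodesic :: "(real^4) set \<Rightarrow> bool" where
  "is_geodesic G \<longleftrightarrow> (\<exists>V. subspace V \<and> dim V = 2 \<and> (\<exists>x\<in>V. time_like x) \<and> G = V \<inter> H3)"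

text \<open>If \<open>A = V \<inter> H3\<close> is a plane or a geodesic, then \<open>V\<close> is recovered as \<open>span A\<close>.
  Ideal points are represented by all of their positive light-like representatives.\<close>

definition ideal_boundary :: "(real^4) set \<Rightarrow> (real^4) set" where
  "ideal_boundary A = {x. positive_vec x \<and> light_like x} \<inter> span A"

definition parallel_planes :: "(real^4) set \<Rightarrow> (real^4) set \<Rightarrow> bool" where
  "parallel_planes P Q \<longleftrightarrow> P \<inter> Q = {} \<and> ideal_boundary P \<inter> ideal_boundary Q \<noteq> {}"

text \<open>The closed sides of \<open>B\<close> in \<open>A\<close>: for a plane \<open>P\<close>, the half-spaces bounded by \<open>P\<close> are the
  sides of \<open>P\<close> in \<open>H3\<close>, and for a geodesic \<open>G\<close> in a plane \<open>Q\<close>, the half-planes of \<open>Q\<close> bounded by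
  \<open>G\<close> are the sides of \<open>G\<close> in \<open>Q\<close>. The interior of such a side \<open>S\<close>, relative to \<open>A\<close>, is
  \<open>S - B\<close>. In \<open>side_ideal_boundary\<close>, the argument \<open>V\<close> is the linear subspace with
  \<open>A = V \<inter> H3\<close>.\<close>

definition is_side :: "(real^4) set \<Rightarrow> (real^4) set \<Rightarrow> (real^4) set \<Rightarrow> bool" where
  "is_side A B S \<longleftrightarrow> (\<exists>C \<in> components (A - B). S = closure C)"

definition side_ideal_boundary ::
    "(real^4) set \<Rightarrow> (real^4) set \<Rightarrow> (real^4) set \<Rightarrow> (real^4) set" where
  "side_ideal_boundary V B S = {x. positive_vec x \<and> light_like x \<and>
     (\<exists>D \<in> components (V - span B). S - B \<subseteq> D \<and> x \<in> closure D)}"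

definition is_half_space :: "(real^4) set \<Rightarrow> (real^4) set \<Rightarrow> bool" where
  "is_half_space P S \<longleftrightarrow> is_side H3 P S"

definition half_space_ideal_boundary :: "(real^4) set \<Rightarrow> (real^4) set \<Rightarrow> (real^4) set" where
  "half_space_ideal_boundary P S = side_ideal_boundary UNIV P S"

text \<open>The tangent space at \<open>p\<close> of \<open>A = V \<inter> H3\<close> consists of the vectors of \<open>V\<close> orthogonal
  to \<open>p\<close>.\<close>

definition geodesic_perp_plane :: "(real^4) set \<Rightarrow> (real^4) set \<Rightarrow> bool" where
  "geodesic_perp_plane G P \<longleftrightarrow> (\<exists>p \<in> G \<inter> P. \<forall>v\<in>span G. \<forall>w\<in>span P.
     v \<bullet>\<^sub>L p = 0 \<longrightarrow> w \<bullet>\<^sub>L p = 0 \<longrightarrow> v \<bullet>\<^sub>L w = 0)"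

text \<open>Two planes meet at a right angle when they meet and their normals are orthogonal.\<close>

definition planes_perp :: "(real^4) set \<Rightarrow> (real^4) set \<Rightarrow> bool" where
  "planes_perp P Q \<longleftrightarrow> P \<inter> Q \<noteq> {} \<and>
     (\<forall>m n. (\<forall>v\<in>P. m \<bullet>\<^sub>L v = 0) \<longrightarrow> (\<forall>w\<in>Q. n \<bullet>\<^sub>L w = 0) \<longrightarrow> m \<bullet>\<^sub>L n = 0)"

definition segment :: "real^4 \<Rightarrow> real^4 \<Rightarrow> (real^4) set" where
  "segment u v = {w \<in> H3. hdist u w + hdist w v = hdist u v}"

text \<open>The geodesic ray from \<open>p\<close> with ideal endpoint \<open>[x]\<close> is cut out of \<open>H3\<close> by the convex cone
  spanned by \<open>p\<close> and \<open>x\<close>.\<close>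

definition ray :: "real^4 \<Rightarrow> real^4 \<Rightarrow> (real^4) set" where
  "ray p x = {w \<in> H3. \<exists>s\<ge>0. \<exists>t\<ge>0. w = s *\<^sub>R p + t *\<^sub>R x}"

definition shortest_arc :: "(real^4) set \<Rightarrow> (real^4) set \<Rightarrow> (real^4) set" where
  "shortest_arc A B = (THE g. \<exists>u\<in>A. \<exists>v\<in>B. g = segment u v \<and>
     (\<forall>u'\<in>A. \<forall>v'\<in>B. hdist u v \<le> hdist u' v'))"

text \<open>The length of a shortest geodesic arc with one endpoint on \<open>A\<close> and one on \<open>B\<close>; it is \<open>0\<close>
  if \<open>A\<close> and \<open>B\<close> are subsets of \<open>H3\<close> that intersect.\<close>

definition shortest_arc_length :: "(real^4) set \<Rightarrow> (real^4) set \<Rightarrow> real" where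
  "shortest_arc_length A B = (LEAST l. \<exists>u\<in>A. \<exists>v\<in>B. l = hdist u v)"

definition perp_geodesic_to :: "(real^4) set \<Rightarrow> real^4 \<Rightarrow> (real^4) set" where
  "perp_geodesic_to P x =
     (THE G. is_geodesic G \<and> geodesic_perp_plane G P \<and> x \<in> ideal_boundary G)"

definition perp_ray_to :: "(real^4) set \<Rightarrow> real^4 \<Rightarrow> (real^4) set" where
  "perp_ray_to P x = (THE R. \<exists>p \<in> perp_geodesic_to P x \<inter> P. R = ray p x)"

definition common_perp :: "(real^4) set \<Rightarrow> (real^4) set \<Rightarrow> (real^4) set" where
  "common_perp P Q =
     (THE G. is_geodesic G \<and> geodesic_perp_plane G P \<and> geodesic_perp_plane G Q)"

definition signed_dist_horoball :: "real^4 \<Rightarrow> real^4 \<Rightarrow> real" where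
  "signed_dist_horoball x v =
     (if v \<in> horoball x then - (INF s\<in>horosphere x. hdist v s)
      else (INF s\<in>horosphere x. hdist v s))"

definition plane_horoball_dist :: "(real^4) set \<Rightarrow> real^4 \<Rightarrow> real" where
  "plane_horoball_dist P x = (LEAST h. \<exists>p\<in>P. h = signed_dist_horoball x p)"


text \<open>The partially truncated tetrahedron determined by planes \<open>P 1\<close>, \<open>P 2\<close>, \<open>P 3\<close> and the
  horoball defined by \<open>x\<close>.\<close>

definition is_face_half_space ::
    "(nat \<Rightarrow> (real^4) set) \<Rightarrow> real^4 \<Rightarrow> nat \<Rightarrow> (real^4) set \<Rightarrow> bool" where
  "is_face_half_space P x i S \<longleftrightarrow> is_half_space (P i) S \<and>
     (\<forall>j\<in>{1,2,3} - {i}. P j \<subseteq> S) \<and> x \<in> half_space_ideal_boundary (P i) S"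

definition face_half_space :: "(nat \<Rightarrow> (real^4) set) \<Rightarrow> real^4 \<Rightarrow> nat \<Rightarrow> (real^4) set" where
  "face_half_space P x i = (THE S. is_face_half_space P x i S)"

definition hat_plane :: "(nat \<Rightarrow> (real^4) set) \<Rightarrow> real^4 \<Rightarrow> nat \<Rightarrow> (real^4) set" where
  "hat_plane P x i =
     (THE Q. is_plane Q \<and> (\<forall>j\<in>{1,2,3} - {i}. planes_perp Q (P j)) \<and> x \<in> ideal_boundary Q)"

definition hat_plane_4 :: "(nat \<Rightarrow> (real^4) set) \<Rightarrow> (real^4) set" where
  "hat_plane_4 P = (THE Q. is_plane Q \<and> (\<forall>j\<in>{1,2,3}. planes_perp Q (P j)))"

definition hat_half_space :: "(nat \<Rightarrow> (real^4) set) \<Rightarrow> real^4 \<Rightarrow> nat \<Rightarrow> (real^4) set" where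
  "hat_half_space P x i =
     (THE S. is_half_space (hat_plane P x i) S \<and>
        (\<forall>j\<in>{1,2,3} - {i}. shortest_arc (P j) (P i) \<subseteq> S) \<and> perp_ray_to (P i) x \<subseteq> S)"

definition hat_half_space_4 :: "(nat \<Rightarrow> (real^4) set) \<Rightarrow> real^4 \<Rightarrow> (real^4) set" where
  "hat_half_space_4 P x =
     (THE S. is_half_space (hat_plane_4 P) S \<and> (\<forall>j\<in>{1,2,3}. perp_geodesic_to (P j) x \<subseteq> S))"

definition generic_body :: "(nat \<Rightarrow> (real^4) set) \<Rightarrow> real^4 \<Rightarrow> (real^4) set" where
  "generic_body P x = (\<Inter>i\<in>{1,2,3}. face_half_space P x i) \<inter>
     (\<Inter>i\<in>{1,2,3}. hat_half_space P x i) \<inter> hat_half_space_4 P x"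

text \<open>In the degenerate case all hat planes coincide with one plane \<open>Q\<close>. The half-plane of \<open>Q\<close>
  bounded by the common perpendicular of \<open>P a\<close> and \<open>P b\<close> contains the remaining line
  \<open>P c \<inter> Q\<close> and has \<open>x\<close> in its ideal boundary; the one bounded by the perpendicular to \<open>P a\<close> in the
  direction of \<open>x\<close> contains both remaining lines \<open>P b \<inter> Q\<close> and \<open>P c \<inter> Q\<close>.\<close>

definition half_plane_internal ::
    "(nat \<Rightarrow> (real^4) set) \<Rightarrow> real^4 \<Rightarrow> (real^4) set \<Rightarrow> nat \<Rightarrow> nat \<Rightarrow> nat \<Rightarrow> (real^4) set" where
  "half_plane_internal P x Q a b c =
     (THE S. is_side Q (common_perp (P a) (P b)) S \<and> P c \<inter> Q \<subseteq> S \<and>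
        x \<in> side_ideal_boundary (span Q) (common_perp (P a) (P b)) S)"

definition half_plane_ideal ::
    "(nat \<Rightarrow> (real^4) set) \<Rightarrow> real^4 \<Rightarrow> (real^4) set \<Rightarrow> nat \<Rightarrow> nat \<Rightarrow> nat \<Rightarrow> (real^4) set" where
  "half_plane_ideal P x Q a b c =
     (THE S. is_side Q (perp_geodesic_to (P a) x) S \<and> P b \<inter> Q \<subseteq> S \<and> P c \<inter> Q \<subseteq> S)"

definition separates_from ::
    "(real^4) set \<Rightarrow> (real^4) set \<Rightarrow> (real^4) set \<Rightarrow> real^4 \<Rightarrow> bool" where
  "separates_from Q G A x \<longleftrightarrow>
     (\<exists>S. is_side Q G S \<and> A \<subseteq> S \<and> x \<notin> side_ideal_boundary (span Q) G S)"

text \<open>The triple \<open>(a, b, c)\<close> is the renumbering \<open>(1, 2, 3)\<close> of the planes. It is unique up to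
  exchanging \<open>a\<close> and \<open>c\<close>, which does not affect the resulting set.\<close>

definition degenerate_body :: "(nat \<Rightarrow> (real^4) set) \<Rightarrow> real^4 \<Rightarrow> (real^4) set" where
  "degenerate_body P x = (let Q = hat_plane P x 1 in
     (THE D. \<exists>a b c. {a, b, c} = {1, 2, 3} \<and>
        separates_from Q (common_perp (P a) (P c)) (P b \<inter> Q) x \<and>
        D = Q \<inter> (\<Inter>i\<in>{1,2,3}. face_half_space P x i) \<inter>
            half_plane_internal P x Q a b c \<inter> half_plane_internal P x Q b c a \<inter>
            half_plane_ideal P x Q c a b \<inter> half_plane_ideal P x Q a b c))"

record trunc_tetrahedron =
  face_plane :: "nat \<Rightarrow> (real^4) set"
  ideal_vertex :: "real^4"
  body :: "(real^4) set"

definition trunc_tetrahedron_of :: "(nat \<Rightarrow> (real^4) set) \<Rightarrow> real^4 \<Rightarrow> trunc_tetrahedron" where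
  "trunc_tetrahedron_of P x =
     \<lparr> face_plane = P, ideal_vertex = x,
       body = (if planes_perp (hat_plane P x 1) (P 1) then degenerate_body P x
               else generic_body P x) \<rparr>"

definition edge :: "trunc_tetrahedron \<Rightarrow> nat \<Rightarrow> nat \<Rightarrow> (real^4) set" where
  "edge \<Delta> i j = shortest_arc (face_plane \<Delta> i) (face_plane \<Delta> j)"

definition edge_length :: "trunc_tetrahedron \<Rightarrow> nat \<Rightarrow> nat \<Rightarrow> real" where
  "edge_length \<Delta> i j = shortest_arc_length (face_plane \<Delta> i) (face_plane \<Delta> j)"

text \<open>The edge from face \<open>k\<close> to the ideal vertex, and its signed length up to the horoball.\<close>

definition ideal_edge :: "trunc_tetrahedron \<Rightarrow> nat \<Rightarrow> (real^4) set" where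
  "ideal_edge \<Delta> k = perp_ray_to (face_plane \<Delta> k) (ideal_vertex \<Delta>)"

definition ideal_edge_length :: "trunc_tetrahedron \<Rightarrow> nat \<Rightarrow> real" where
  "ideal_edge_length \<Delta> k = plane_horoball_dist (face_plane \<Delta> k) (ideal_vertex \<Delta>)"

text \<open>The length of the transversal joining the edge between faces \<open>i\<close> and \<open>j\<close> to the opposite
  edge, which joins the remaining face \<open>k\<close> to the ideal vertex.\<close>

definition transversal_length :: "trunc_tetrahedron \<Rightarrow> nat \<Rightarrow> nat \<Rightarrow> nat \<Rightarrow> real" where
  "transversal_length \<Delta> i j k = shortest_arc_length (edge \<Delta> i j) (ideal_edge \<Delta> k)"

end

theory Submission
  imports Defs
begin

text \<open>Let \<open>n\<^sub>i\<close> be the unit normal of \<open>P\<^sub>i\<close> pointing away from the half-space \<open>H\<^sub>i\<close>. Then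
  \<open>cosh \<ell>\<^sub>i\<^sub>j = - n\<^sub>i \<circ> n\<^sub>j\<close> and \<open>exp h\<^sub>i\<^sub>4 = - n\<^sub>i \<circ> x\<^sub>4\<close>, so all edge data of the tetrahedron are entries of
  the Gram matrix of \<open>n\<^sub>1, n\<^sub>2, n\<^sub>3, x\<^sub>4\<close>. A point \<open>w\<close> of \<open>\<lambda>\<^sub>i\<^sub>j\<close> is \<open>\<sigma> n\<^sub>i + \<tau> n\<^sub>j\<close> with \<open>\<sigma>, \<tau> \<ge> 0\<close>; put
  \<open>A = - w \<circ> n\<^sub>k = \<sigma> a + \<tau> b\<close> and \<open>C = - w \<circ> x\<^sub>4 = \<sigma> c + \<tau> d\<close>. By the arithmetic-geometric mean
  inequality, the distance of \<open>w\<close> to the geodesic through \<open>\<lambda>\<^sub>k\<^sub>4\<close> has hyperbolic cosine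
  \<open>sqrt (C / y * (C / y + 2 * A))\<close>, and \<open>A \<ge> 0\<close> puts the nearest point on the ray \<open>\<lambda>\<^sub>k\<^sub>4\<close> itself.
  Since \<open>w \<circ> w = -1\<close> gives \<open>(\<sigma> + \<tau>)\<^sup>2 \<ge> 2 / (x - 1)\<close>, with equality at the midpoint \<open>\<sigma> = \<tau>\<close>
  of \<open>\<lambda>\<^sub>i\<^sub>j\<close>, the bound follows from \<open>A \<ge> (\<sigma> + \<tau>) L\<close> and \<open>C \<ge> (\<sigma> + \<tau>) H\<close>.\<close>

section \<open>Lorentz geometry\<close>

lemma lorentz_commute: "u \<bullet>\<^sub>L v = v \<bullet>\<^sub>L u"
  by (simp add: lorentz_def mult.commute)

lemma lorentz_simps:
  "(u + v) \<bullet>\<^sub>L w = u \<bullet>\<^sub>L w + v \<bullet>\<^sub>L w" "w \<bullet>\<^sub>L (u + v) = w \<bullet>\<^sub>L u + w \<bullet>\<^sub>L v"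
  "(u - v) \<bullet>\<^sub>L w = u \<bullet>\<^sub>L w - v \<bullet>\<^sub>L w" "w \<bullet>\<^sub>L (u - v) = w \<bullet>\<^sub>L u - w \<bullet>\<^sub>L v"
  "(r *\<^sub>R u) \<bullet>\<^sub>L w = r * (u \<bullet>\<^sub>L w)" "w \<bullet>\<^sub>L (r *\<^sub>R u) = r * (w \<bullet>\<^sub>L u)"
  "(- u) \<bullet>\<^sub>L w = - (u \<bullet>\<^sub>L w)" "w \<bullet>\<^sub>L (- u) = - (w \<bullet>\<^sub>L u)"
  "0 \<bullet>\<^sub>L w = 0" "w \<bullet>\<^sub>L 0 = 0"
  by (simp_all add: lorentz_def algebra_simps)

lemma continuous_on_lorentz [continuous_intros]:
  "continuous_on S f \<Longrightarrow> continuous_on S g \<Longrightarrow> continuous_on S (\<lambda>z. f z \<bullet>\<^sub>L g z)"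
  unfolding lorentz_def by (intro continuous_intros)

lemma subspace_lorentz_orthogonal: "subspace {v. n \<bullet>\<^sub>L v = 0}"
  by (simp add: subspace_def lorentz_simps)

lemma H3_norm: "u \<in> H3 \<Longrightarrow> u \<bullet>\<^sub>L u = -1"
  by (simp add: H3_def)

lemma H3_positive: "u \<in> H3 \<Longrightarrow> u $ 1 > 0"
  by (simp add: H3_def positive_vec_def)

section \<open>Cauchy-Schwarz inequalities for time-like and light-like vectors\<close>

lemma Cauchy_Schwarz_3:
  fixes a b c x y z :: real
  shows "(a * x + b * y + c * z)\<^sup>2 \<le> (a\<^sup>2 + b\<^sup>2 + c\<^sup>2) * (x\<^sup>2 + y\<^sup>2 + z\<^sup>2)"
proof -
  have "(a\<^sup>2 + b\<^sup>2 + c\<^sup>2) * (x\<^sup>2 + y\<^sup>2 + z\<^sup>2) - (a * x + b * y + c * z)\<^sup>2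
      = (a * y - b * x)\<^sup>2 + (a * z - c * x)\<^sup>2 + (b * z - c * y)\<^sup>2"
    by algebra
  moreover have "\<dots> \<ge> 0"
    by simp
  ultimately show ?thesis
    by linarith
qed

text \<open>The form is positive definite on the complement of a time-like vector: Cauchy-Schwarz in
  the last three coordinates bounds \<open>(v $ 1)\<^sup>2 * (p $ 1)\<^sup>2\<close> by
  \<open>(v $ 1)\<^sup>2 * A\<close>, and \<open>A < (p $ 1)\<^sup>2\<close> forces
  \<open>v $ 1 = 0\<close>. Later equality and uniqueness arguments rest on this.\<close>

lemma orthogonal_time_like_zero:
  assumes p: "p \<bullet>\<^sub>L p < 0" and "v \<bullet>\<^sub>L p = 0" and vv: "v \<bullet>\<^sub>L v \<le> 0"
  shows "v = 0"
proof -
  define A B where "A = (p $ 2)\<^sup>2 + (p $ 3)\<^sup>2 + (p $ 4)\<^sup>2" and "B = (v $ 2)\<^sup>2 + (v $ 3)\<^sup>2 + (v $ 4)\<^sup>2"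
  have A: "A < (p $ 1)\<^sup>2" and B: "B \<le> (v $ 1)\<^sup>2" and B0: "B \<ge> 0" and A0: "A \<ge> 0"
    using p vv by (simp_all add: A_def B_def lorentz_def power2_eq_square)
  have "v $ 1 * p $ 1 = v $ 2 * p $ 2 + v $ 3 * p $ 3 + v $ 4 * p $ 4"
    using assms(2) by (simp add: lorentz_def)
  then have "(v $ 1)\<^sup>2 * (p $ 1)\<^sup>2 \<le> B * A"
    using Cauchy_Schwarz_3[of "v $ 2" "p $ 2" "v $ 3" "p $ 3" "v $ 4" "p $ 4"]
    by (simp add: A_def B_def power_mult_distrib [symmetric])
  also have "\<dots> \<le> (v $ 1)\<^sup>2 * A"
    using B A0 by (rule mult_right_mono)
  finally have "(v $ 1)\<^sup>2 * ((p $ 1)\<^sup>2 - A) \<le> 0"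
    by (simp add: algebra_simps)
  then have "(v $ 1)\<^sup>2 \<le> 0"
    using A by (simp add: mult_le_0_iff)
  then have "v $ 1 = 0" "B = 0"
    using B B0 by auto
  then have "v $ 2 = 0" "v $ 3 = 0" "v $ 4 = 0"
    by (simp_all add: B_def add_nonneg_eq_0_iff)
  with \<open>v $ 1 = 0\<close> show ?thesis
    by (simp add: vec_eq_iff forall_4)
qed

text \<open>Taking \<open>z\<close> from the closed future cone covers points of \<open>H3\<close>
  and light-like vectors at once; strictness comes from the time-like \<open>u\<close>.\<close>

lemma lorentz_neg:
  assumes u: "u \<in> H3" and z: "positive_vec z" "z \<bullet>\<^sub>L z \<le> 0"
  shows "u \<bullet>\<^sub>L z < 0"
proof -
  define A B where "A = (u $ 2)\<^sup>2 + (u $ 3)\<^sup>2 + (u $ 4)\<^sup>2" and "B = (z $ 2)\<^sup>2 + (z $ 3)\<^sup>2 + (z $ 4)\<^sup>2"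
  have z1: "z $ 1 > 0" and u1: "u $ 1 > 0"
    using z u by (simp_all add: positive_vec_def H3_def)
  have A: "A < (u $ 1)\<^sup>2" and B: "B \<le> (z $ 1)\<^sup>2" and A0: "A \<ge> 0"
    using H3_norm[OF u] z by (simp_all add: A_def B_def lorentz_def power2_eq_square)
  have "(u $ 2 * z $ 2 + u $ 3 * z $ 3 + u $ 4 * z $ 4)\<^sup>2 \<le> A * B"
    unfolding A_def B_def by (rule Cauchy_Schwarz_3)
  also have "\<dots> \<le> A * (z $ 1)\<^sup>2"
    using B A0 by (rule mult_left_mono)
  also have "\<dots> < (u $ 1)\<^sup>2 * (z $ 1)\<^sup>2"
    using A z1 by simp
  finally have "(u $ 2 * z $ 2 + u $ 3 * z $ 3 + u $ 4 * z $ 4)\<^sup>2 < (u $ 1 * z $ 1)\<^sup>2"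
    by (simp add: power_mult_distrib)
  then have "u $ 2 * z $ 2 + u $ 3 * z $ 3 + u $ 4 * z $ 4 < u $ 1 * z $ 1"
    by (rule power_less_imp_less_base) (use u1 z1 in simp)
  then show ?thesis
    by (simp add: lorentz_def)
qed

text \<open>A test for the right sheet that avoids first coordinates: \<open>lorentz_neg\<close>
  applied to \<open>- z\<close> excludes the lower sheet. The test vector \<open>u\<close> will be a
  point of \<open>H3\<close> or the light-like vector of the ideal vertex.\<close>

lemma in_H3_if_lorentz_neg:
  assumes u: "positive_vec u" "u \<bullet>\<^sub>L u \<le> 0" and z: "z \<bullet>\<^sub>L z = -1" and "z \<bullet>\<^sub>L u < 0"
  shows "z \<in> H3"
proof (rule ccontr)
  assume "z \<notin> H3"
  then have "z $ 1 \<le> 0"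
    using z by (simp add: H3_def positive_vec_def)
  moreover have "z $ 1 \<noteq> 0"
  proof
    assume "z $ 1 = 0"
    then have "z \<bullet>\<^sub>L z \<ge> 0"
      by (simp add: lorentz_def)
    with z show False
      by simp
  qed
  ultimately have "- z \<in> H3"
    using z by (simp add: H3_def positive_vec_def lorentz_simps)
  then show False
    using lorentz_neg[OF _ u] \<open>z \<bullet>\<^sub>L u < 0\<close> by (fastforce simp: lorentz_simps)
qed

text \<open>The part \<open>z\<close> of \<open>v\<close> orthogonal to \<open>u\<close> has square
  \<open>g\<^sup>2 - 1\<close>, so definiteness on the complement of \<open>u\<close> leaves only
  \<open>z = 0\<close> when \<open>g \<le> 1\<close>.\<close>

lemma reverse_Cauchy_Schwarz:
  assumes u: "u \<in> H3" and v: "v \<in> H3"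
  shows "- (u \<bullet>\<^sub>L v) \<ge> 1" and "- (u \<bullet>\<^sub>L v) \<le> 1 \<Longrightarrow> u = v"
proof -
  define g where "g = - (u \<bullet>\<^sub>L v)"
  have g: "g > 0"
    using lorentz_neg[OF u, of v] v by (simp add: g_def H3_def)
  have vu: "v \<bullet>\<^sub>L u = - g"
    by (simp add: g_def lorentz_commute)
  have uv: "u \<bullet>\<^sub>L v = - g"
    by (simp add: g_def)
  define z where "z = v - g *\<^sub>R u"
  have zz: "z \<bullet>\<^sub>L z = g\<^sup>2 - 1" and zu: "z \<bullet>\<^sub>L u = 0"
    by (simp_all add: z_def lorentz_simps uv vu H3_norm u v power2_eq_square)
  have "z = 0" if "g \<le> 1"
    using orthogonal_time_like_zero[of u z] zz zu H3_norm[OF u] that g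
    by (simp add: power_le_one)
  then have *: "u = v \<and> g = 1" if "g \<le> 1"
    using that zz g by (auto simp: z_def lorentz_simps power2_eq_1_iff)
  show "- (u \<bullet>\<^sub>L v) \<ge> 1"
    using * by (fold g_def) linarith
  show "- (u \<bullet>\<^sub>L v) \<le> 1 \<Longrightarrow> u = v"
    using * by (simp add: g_def)
qed

lemma time_like_normalize:
  assumes "z \<bullet>\<^sub>L z < 0"
  obtains c where "c \<noteq> 0" "c *\<^sub>R z \<in> H3"
proof -
  have z1: "z $ 1 \<noteq> 0"
  proof
    assume "z $ 1 = 0"
    then have "z \<bullet>\<^sub>L z \<ge> 0"
      by (simp add: lorentz_def)
    with assms show False
      by simp
  qed
  define c where "c = sgn (z $ 1) / sqrt (- (z \<bullet>\<^sub>L z))"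
  have "c * c * (z \<bullet>\<^sub>L z) = -1"
    using assms z1 by (simp add: c_def sgn_if)
  moreover have "c * z $ 1 > 0"
    using assms z1 by (auto simp: c_def sgn_if divide_less_0_iff)
  moreover from this have "c \<noteq> 0"
    by auto
  ultimately show ?thesis
    using that[of c] by (simp add: H3_def positive_vec_def lorentz_simps mult.assoc)
qed

text \<open>Every \<open>v\<close> in \<open>V\<close> is the difference of
  \<open>M *\<^sub>R p + v\<close> and \<open>M *\<^sub>R p\<close>; for large \<open>M\<close> both
  are time-like, hence multiples of points of \<open>V \<inter> H3\<close>.\<close>

lemma span_Int_H3:
  assumes V: "subspace V" and z: "z \<in> V" "z \<bullet>\<^sub>L z < 0"
  shows "span (V \<inter> H3) = V"
proof
  show "span (V \<inter> H3) \<subseteq> V"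
    by (rule span_minimal) (use V in auto)
  obtain c where c: "c *\<^sub>R z \<in> H3"
    using time_like_normalize[OF z(2)] by blast
  define p where "p = c *\<^sub>R z"
  have p: "p \<in> H3" "p \<in> V"
    using c z V by (auto simp: p_def subspace_scale)
  show "V \<subseteq> span (V \<inter> H3)"
  proof
    fix v assume v: "v \<in> V"
    \<comment> \<open>Large enough that \<open>- (M * M)\<close> outweighs the mixed term and
      \<open>v \<bullet>\<^sub>L v\<close>, leaving at most \<open>- M\<close>.\<close>
    define M where "M = 1 + 2 * \<bar>p \<bullet>\<^sub>L v\<bar> + \<bar>v \<bullet>\<^sub>L v\<bar>"
    define q where "q = M *\<^sub>R p + v"
    have M: "M \<ge> 1" by (simp add: M_def)
    have "q \<bullet>\<^sub>L q = - (M * M) + M * (2 * (p \<bullet>\<^sub>L v)) + v \<bullet>\<^sub>L v"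
      using H3_norm[OF p(1)]
      by (simp add: q_def lorentz_simps lorentz_commute[of v p] algebra_simps)
    also have "\<dots> \<le> - (M * M) + M * (2 * \<bar>p \<bullet>\<^sub>L v\<bar>) + M * \<bar>v \<bullet>\<^sub>L v\<bar>"
      using M mult_right_mono[OF M, of "\<bar>v \<bullet>\<^sub>L v\<bar>"] by (intro add_mono mult_left_mono) auto
    also have "\<dots> = - M"
      by (simp add: M_def algebra_simps)
    finally have "q \<bullet>\<^sub>L q < 0"
      using M by simp
    then obtain d where d: "d \<noteq> 0" "d *\<^sub>R q \<in> H3"
      using time_like_normalize by blast
    have "q \<in> V"
      using V v p by (simp add: q_def subspace_add subspace_scale)
    then have "d *\<^sub>R q \<in> span (V \<inter> H3)"
      using V d by (intro span_base) (simp add: subspace_scale)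
    then have "(1 / d) *\<^sub>R (d *\<^sub>R q) \<in> span (V \<inter> H3)"
      by (rule span_scale)
    then have "q \<in> span (V \<inter> H3)"
      using d by simp
    moreover have "M *\<^sub>R p \<in> span (V \<inter> H3)"
      using p by (intro span_scale span_base) simp
    ultimately show "v \<in> span (V \<inter> H3)"
      using span_diff by (fastforce simp: q_def)
  qed
qed

section \<open>Planes and their normals\<close>

definition normal_plane :: "real^4 \<Rightarrow> (real^4) set" where
  "normal_plane n = {v \<in> H3. n \<bullet>\<^sub>L v = 0}"

lemma is_plane_imp_normal_plane:
  assumes "is_plane P"
  obtains n where "n \<bullet>\<^sub>L n = 1" "P = normal_plane n"
proof -
  obtain V t where V: "subspace V" "dim V = 3" "t \<in> V" "time_like t" and P: "P = V \<inter> H3"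
    using assms by (auto simp: is_plane_def)
  obtain a where a: "a \<noteq> 0" "span V = {x. a \<bullet> x = 0}"
    using lowdim_eq_hyperplane[of V] V by auto
  \<comment> \<open>Negating the first coordinate turns the Euclidean normal into a Lorentz
    normal.\<close>
  define m :: "real^4" where "m = (\<chi> l. if l = 1 then - (a $ 1) else a $ l)"
  have m: "m \<bullet>\<^sub>L x = a \<bullet> x" for x
    by (simp add: m_def lorentz_def inner_vec_def sum_4)
  have V_eq: "V = {x. m \<bullet>\<^sub>L x = 0}"
    using a V by (simp add: m span_eq_iff[THEN iffD2])
  have "m \<noteq> 0"
    using a m[of a] by (auto simp: lorentz_simps)
  \<comment> \<open>The normal is space-like because it is orthogonal to the time-like vector
    \<open>t\<close> of \<open>V\<close>.\<close>
  then have mm: "m \<bullet>\<^sub>L m > 0"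
    using orthogonal_time_like_zero[of t m] V V_eq by (force simp: time_like_def)
  define n where "n = (1 / sqrt (m \<bullet>\<^sub>L m)) *\<^sub>R m"
  have "n \<bullet>\<^sub>L n = 1"
    using mm by (simp add: n_def lorentz_simps)
  moreover have "P = normal_plane n"
    using mm P V_eq by (auto simp: normal_plane_def n_def lorentz_simps)
  ultimately show ?thesis
    by (rule that)
qed

lemma normal_plane_uminus: "normal_plane (- n) = normal_plane n"
  by (simp add: normal_plane_def lorentz_simps)

lemma normal_plane_nonempty:
  assumes "n \<bullet>\<^sub>L n = 1"
  obtains p where "p \<in> normal_plane n"
proof -
  define e :: "real^4" where "e = axis 1 1"
  have "e \<bullet>\<^sub>L e = -1"
    by (simp add: e_def lorentz_def axis_def)
  \<comment> \<open>Removing the component along the space-like \<open>n\<close> only makes the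
    square of the time-like \<open>e\<close> more negative.\<close>
  define z where "z = e - (n \<bullet>\<^sub>L e) *\<^sub>R n"
  have nz: "n \<bullet>\<^sub>L z = 0"
    by (simp add: z_def lorentz_simps assms)
  have "z \<bullet>\<^sub>L z = -1 - (n \<bullet>\<^sub>L e)\<^sup>2"
    by (simp add: z_def lorentz_simps assms \<open>e \<bullet>\<^sub>L e = -1\<close> lorentz_commute[of e n] power2_eq_square)
  moreover have "(n \<bullet>\<^sub>L e)\<^sup>2 \<ge> 0"
    by simp
  ultimately have "z \<bullet>\<^sub>L z < 0"
    by linarith
  then obtain c where "c *\<^sub>R z \<in> H3"
    using time_like_normalize by blast
  then show ?thesis
    using that[of "c *\<^sub>R z"] nz by (simp add: normal_plane_def lorentz_simps)
qed

lemma span_normal_plane: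
  assumes "n \<bullet>\<^sub>L n = 1"
  shows "span (normal_plane n) = {v. n \<bullet>\<^sub>L v = 0}"
proof -
  obtain p where "p \<in> normal_plane n"
    using normal_plane_nonempty[OF assms] .
  then have "p \<in> {v. n \<bullet>\<^sub>L v = 0}" "p \<bullet>\<^sub>L p < 0"
    by (auto simp: normal_plane_def H3_norm)
  from span_Int_H3[OF subspace_lorentz_orthogonal this]
  show ?thesis
    by (simp add: normal_plane_def Int_def conj_commute)
qed

text \<open>If the Gram entry \<open>g\<close> has absolute value below 1, the normals span a
  positive definite plane, and projecting off it yields a common point. If the absolute value is 1,
  the planes coincide or share the ideal point of \<open>z\<close>.\<close>

lemma gram_of_disjoint_nonparallel:
  assumes n: "n \<bullet>\<^sub>L n = 1" and m: "m \<bullet>\<^sub>L m = 1"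
    and disj: "normal_plane n \<inter> normal_plane m = {}"
    and npar: "\<not> parallel_planes (normal_plane n) (normal_plane m)"
  shows "(n \<bullet>\<^sub>L m)\<^sup>2 > 1"
proof (rule ccontr)
  assume le: "\<not> (n \<bullet>\<^sub>L m)\<^sup>2 > 1"
  define g where "g = n \<bullet>\<^sub>L m"
  have mn: "m \<bullet>\<^sub>L n = g" "n \<bullet>\<^sub>L m = g"
    by (simp_all add: g_def lorentz_commute)
  define z where "z = m - g *\<^sub>R n"
  have zz: "z \<bullet>\<^sub>L z = 1 - g\<^sup>2" and nz: "n \<bullet>\<^sub>L z = 0" and mz: "m \<bullet>\<^sub>L z = 1 - g\<^sup>2"
    by (simp_all add: z_def lorentz_simps n m mn power2_eq_square)
  obtain p where p: "p \<in> normal_plane n"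
    using normal_plane_nonempty[OF n] .
  then have pp: "p \<in> H3" "n \<bullet>\<^sub>L p = 0" "p \<bullet>\<^sub>L n = 0" "p \<bullet>\<^sub>L p = -1"
    by (auto simp: normal_plane_def H3_norm lorentz_commute)
  show False
  proof (cases "g\<^sup>2 < 1")
    case True
    define q where "q = m \<bullet>\<^sub>L p"
    have q: "m \<bullet>\<^sub>L p = q" "p \<bullet>\<^sub>L m = q"
      by (simp_all add: q_def lorentz_commute)
    \<comment> \<open>The component of \<open>p\<close> orthogonal to both normals; it stays
      time-like since \<open>z\<close> is space-like in this case.\<close>
    define w where "w = p - (q / (1 - g\<^sup>2)) *\<^sub>R z"
    have zp: "z \<bullet>\<^sub>L p = q" "p \<bullet>\<^sub>L z = q"
      by (simp_all add: z_def lorentz_simps q pp)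
    have nw: "n \<bullet>\<^sub>L w = 0" "m \<bullet>\<^sub>L w = 0"
      using True by (simp_all add: w_def lorentz_simps pp nz mz q)
    have "w \<bullet>\<^sub>L w = -1 - q\<^sup>2 / (1 - g\<^sup>2)"
      using True by (simp add: w_def lorentz_simps pp zz zp field_simps power2_eq_square)
    moreover have "q\<^sup>2 / (1 - g\<^sup>2) \<ge> 0"
      using True by simp
    ultimately have "w \<bullet>\<^sub>L w < 0"
      by linarith
    then obtain c where "c *\<^sub>R w \<in> H3"
      using time_like_normalize by blast
    then have "c *\<^sub>R w \<in> normal_plane n \<inter> normal_plane m"
      using nw by (simp add: normal_plane_def lorentz_simps)
    with disj show False
      by blast
  next
    case False
    with le have g: "g\<^sup>2 = 1"
      by (simp add: g_def)
    have "z \<noteq> 0"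
    proof
      assume "z = 0"
      then have "m = g *\<^sub>R n"
        by (simp add: z_def)
      then have "p \<in> normal_plane m"
        using p by (simp add: normal_plane_def lorentz_simps)
      with p disj show False
        by blast
    qed
    have "z $ 1 \<noteq> 0"
    proof
      assume "z $ 1 = 0"
      with zz g have "(z $ 2)\<^sup>2 + (z $ 3)\<^sup>2 + (z $ 4)\<^sup>2 = 0"
        by (simp add: lorentz_def power2_eq_square)
      then have "z $ 2 = 0" "z $ 3 = 0" "z $ 4 = 0"
        by (simp_all add: add_nonneg_eq_0_iff)
      with \<open>z $ 1 = 0\<close> \<open>z \<noteq> 0\<close> show False
        by (simp add: vec_eq_iff forall_4)
    qed
    \<comment> \<open>Here \<open>z\<close> is light-like and orthogonal to both normals; the sign
      moves it to the positive cone.\<close>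
    then have "sgn (z $ 1) *\<^sub>R z \<in> ideal_boundary (normal_plane n) \<inter> ideal_boundary (normal_plane m)"
      using g zz nz mz \<open>z \<noteq> 0\<close>
      by (auto simp: ideal_boundary_def span_normal_plane n m positive_vec_def light_like_def
          lorentz_simps sgn_if)
    with disj npar show False
      unfolding parallel_planes_def by blast
  qed
qed

text \<open>This turns the half-space hypothesis into a sign. On the connected set \<open>D\<close>
  the product with \<open>n\<close> never vanishes, so it has one sign there; since \<open>x\<close>
  lies in the closure of \<open>D\<close> and \<open>n \<bullet>\<^sub>L x < 0\<close>, that sign is
  negative.\<close>

lemma face_half_space_side:
  assumes S: "is_face_half_space P x l S" and "P l = normal_plane n" "n \<bullet>\<^sub>L n = 1"
    and "n \<bullet>\<^sub>L x < 0" and j: "j \<in> {1,2,3} - {l}" and disj: "P l \<inter> P j = {}" and v: "v \<in> P j"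
  shows "n \<bullet>\<^sub>L v < 0"
proof -
  obtain D where D: "D \<in> components (UNIV - span (P l))" "S - P l \<subseteq> D" "x \<in> closure D"
    using S by (auto simp: is_face_half_space_def half_space_ideal_boundary_def
        side_ideal_boundary_def)
  have "v \<in> D"
    using S D v j disj by (auto simp: is_face_half_space_def)
  have "open {v. n \<bullet>\<^sub>L v < 0}"
    by (intro open_Collect_less continuous_intros)
  then obtain w where w: "w \<in> D" "n \<bullet>\<^sub>L w < 0"
    using D(3) assms(4) unfolding closure_iff_nhds_not_empty by blast
  have "connected ((\<lambda>v. n \<bullet>\<^sub>L v) ` D)"
    using D(1) by (intro connected_continuous_image continuous_intros in_components_connected)
  from connectedD_interval[OF this imageI[OF w(1)] imageI[OF \<open>v \<in> D\<close>]]
  have "0 \<in> (\<lambda>v. n \<bullet>\<^sub>L v) ` D" if "n \<bullet>\<^sub>L v \<ge> 0"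
    using w that by simp
  moreover have "n \<bullet>\<^sub>L u \<noteq> 0" if "u \<in> D" for u
    using in_components_subset[OF D(1)] that assms(2,3) by (auto simp: span_normal_plane)
  ultimately show ?thesis
    by fastforce
qed

section \<open>Shortest arcs and edges\<close>

lemma hdist_le_iff:
  assumes "u \<in> H3" "v \<in> H3" "u' \<in> H3" "v' \<in> H3"
  shows "hdist u v \<le> hdist u' v' \<longleftrightarrow> - (u \<bullet>\<^sub>L v) \<le> - (u' \<bullet>\<^sub>L v')"
  using arcosh_less_iff_real[of "- (u' \<bullet>\<^sub>L v')" "- (u \<bullet>\<^sub>L v)"] reverse_Cauchy_Schwarz(1) assms
  unfolding hdist_def by (meson not_le)

text \<open>A \<open>LEAST\<close> over the reals has to be attained, hence the explicit minimising
  pair.\<close>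

lemma shortest_arc_length_eqI:
  assumes "u \<in> A" "v \<in> B" "A \<subseteq> H3" "B \<subseteq> H3"
    and "\<And>u' v'. u' \<in> A \<Longrightarrow> v' \<in> B \<Longrightarrow> - (u \<bullet>\<^sub>L v) \<le> - (u' \<bullet>\<^sub>L v')"
  shows "shortest_arc_length A B = arcosh (- (u \<bullet>\<^sub>L v))"
  unfolding shortest_arc_length_def
proof (rule Least_equality)
  show "\<exists>u'\<in>A. \<exists>v'\<in>B. arcosh (- (u \<bullet>\<^sub>L v)) = hdist u' v'"
    using assms(1,2) by (auto simp: hdist_def)
next
  fix l assume "\<exists>u'\<in>A. \<exists>v'\<in>B. l = hdist u' v'"
  then obtain u' v' where "u' \<in> A" "v' \<in> B" "l = hdist u' v'"
    by blast
  with assms have "hdist u v \<le> l"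
    by (auto simp: hdist_le_iff subset_iff)
  then show "arcosh (- (u \<bullet>\<^sub>L v)) \<le> l"
    by (simp add: hdist_def)
qed

text \<open>The point of the plane with normal \<open>m\<close> nearest to the plane with normal \<open>n\<close>, up to sign:
  it is positive when both normals point away from a common ideal point and \<open>m \<circ> n < -1\<close>.\<close>

definition foot :: "real^4 \<Rightarrow> real^4 \<Rightarrow> real^4" where
  "foot m n = (1 / sqrt ((m \<bullet>\<^sub>L n)\<^sup>2 - 1)) *\<^sub>R (n - (m \<bullet>\<^sub>L n) *\<^sub>R m)"

text \<open>The last product will give the distance between the planes, once the feet are known to
  lie in \<open>H3\<close>.\<close>

lemma foot_products:
  assumes "m \<bullet>\<^sub>L m = 1" "n \<bullet>\<^sub>L n = 1" "(m \<bullet>\<^sub>L n)\<^sup>2 > 1"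
  shows "m \<bullet>\<^sub>L foot m n = 0" "foot m n \<bullet>\<^sub>L foot m n = -1"
    "n \<bullet>\<^sub>L foot m n = - sqrt ((m \<bullet>\<^sub>L n)\<^sup>2 - 1)" "foot m n \<bullet>\<^sub>L foot n m = m \<bullet>\<^sub>L n"
proof -
  define g r where "g = m \<bullet>\<^sub>L n" and "r = sqrt (g\<^sup>2 - 1)"
  have g: "m \<bullet>\<^sub>L n = g" "n \<bullet>\<^sub>L m = g"
    by (simp_all add: g_def lorentz_commute)
  have r: "r > 0" and rr: "g * g = r * r + 1"
    using assms by (simp_all add: r_def g_def power2_eq_square [symmetric])
  have f: "foot m n = (1 / r) *\<^sub>R (n - g *\<^sub>R m)" "foot n m = (1 / r) *\<^sub>R (m - g *\<^sub>R n)"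
    by (simp_all add: foot_def g r_def)
  show "m \<bullet>\<^sub>L foot m n = 0"
    by (simp add: f lorentz_simps g assms)
  show "foot m n \<bullet>\<^sub>L foot m n = -1"
    using r by (simp add: f lorentz_simps g assms rr field_simps)
  show "n \<bullet>\<^sub>L foot m n = - sqrt ((m \<bullet>\<^sub>L n)\<^sup>2 - 1)"
    unfolding g r_def [symmetric] using r by (simp add: f lorentz_simps g assms rr field_simps)
  have "foot m n \<bullet>\<^sub>L foot n m = g * (g * g - 1) / (r * r)"
    using r by (simp add: f lorentz_simps g assms field_simps)
  then show "foot m n \<bullet>\<^sub>L foot n m = m \<bullet>\<^sub>L n"
    using r by (simp add: g rr)
qed

text \<open>The Gram condition leaves the sign of \<open>m \<bullet>\<^sub>L n\<close> open. The
  side conditions place positive multiples of both feet in \<open>H3\<close>, where products are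
  negative, and the product of the feet is \<open>m \<bullet>\<^sub>L n\<close> itself.\<close>

lemma lorentz_normals_less:
  assumes m: "m \<bullet>\<^sub>L m = 1" and n: "n \<bullet>\<^sub>L n = 1" and gram: "(m \<bullet>\<^sub>L n)\<^sup>2 > 1"
    and side_m: "\<And>v. v \<in> normal_plane n \<Longrightarrow> m \<bullet>\<^sub>L v < 0"
    and side_n: "\<And>v. v \<in> normal_plane m \<Longrightarrow> n \<bullet>\<^sub>L v < 0"
  shows "m \<bullet>\<^sub>L n < -1"
proof -
  have foot_positive: "\<exists>c>0. c *\<^sub>R foot m n \<in> H3"
    if m: "m \<bullet>\<^sub>L m = 1" and n: "n \<bullet>\<^sub>L n = 1" and gram: "(m \<bullet>\<^sub>L n)\<^sup>2 > 1"
      and side_n: "\<And>v. v \<in> normal_plane m \<Longrightarrow> n \<bullet>\<^sub>L v < 0" for m n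
  proof -
    note f = foot_products[OF m n gram]
    obtain c where c: "c \<noteq> 0" "c *\<^sub>R foot m n \<in> H3"
      using time_like_normalize[of "foot m n"] f(2) by auto
    have "c *\<^sub>R foot m n \<in> normal_plane m"
      using c f by (simp add: normal_plane_def lorentz_simps)
    from side_n[OF this] have "c > 0"
      using gram f(3) by (simp add: lorentz_simps zero_less_mult_iff)
    with c show ?thesis
      by blast
  qed
  obtain c where c: "c > 0" "c *\<^sub>R foot m n \<in> H3"
    using foot_positive[OF m n gram side_n] by blast
  obtain d where d: "d > 0" "d *\<^sub>R foot n m \<in> H3"
    using foot_positive[OF n m _ side_m] gram by (auto simp: lorentz_commute[of n m])
  have "(c *\<^sub>R foot m n) \<bullet>\<^sub>L (d *\<^sub>R foot n m) = c * d * (m \<bullet>\<^sub>L n)"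
    using foot_products(4)[OF m n gram] by (simp add: lorentz_simps)
  then have "c * d * (m \<bullet>\<^sub>L n) < 0"
    using reverse_Cauchy_Schwarz(1)[OF c(2) d(2)] by linarith
  then have "m \<bullet>\<^sub>L n < 0"
    using c(1) d(1) by (auto simp: mult_less_0_iff)
  moreover have "\<bar>m \<bullet>\<^sub>L n\<bar> > 1"
    using gram abs_square_le_1[of "m \<bullet>\<^sub>L n"] by linarith
  ultimately show ?thesis
    by simp
qed

text \<open>The light-like \<open>x\<close> serves as test vector: up to a positive factor, the
  product of the foot with \<open>x\<close> is \<open>n \<bullet>\<^sub>L x - (m \<bullet>\<^sub>L
  n) * (m \<bullet>\<^sub>L x)\<close>, both terms of which are negative.\<close>

lemma foot_in_normal_plane:
  assumes m: "m \<bullet>\<^sub>L m = 1" and n: "n \<bullet>\<^sub>L n = 1" and g: "m \<bullet>\<^sub>L n < -1"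
    and x: "positive_vec x" "light_like x" "m \<bullet>\<^sub>L x < 0" "n \<bullet>\<^sub>L x < 0"
  shows "foot m n \<in> normal_plane m"
proof -
  have gram: "(m \<bullet>\<^sub>L n)\<^sup>2 > 1"
    using g by (smt (verit) one_less_power power2_minus zero_less_numeral)
  note f = foot_products[OF m n gram]
  have "(- (m \<bullet>\<^sub>L n)) * (m \<bullet>\<^sub>L x) < 0"
    using g x by (intro mult_pos_neg) auto
  then have "foot m n \<bullet>\<^sub>L x < 0"
    using x gram by (simp add: foot_def lorentz_simps divide_less_0_iff)
  then have "foot m n \<in> H3"
    using in_H3_if_lorentz_neg[of x "foot m n"] x f by (simp add: light_like_def)
  then show ?thesis
    using f by (simp add: normal_plane_def)
qed

text \<open>Two nested minimisations: for fixed \<open>v\<close> the nearest point of the plane of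
  \<open>m\<close> gives the bound \<open>q\<close>, and \<open>q\<close> depends on
  \<open>v\<close> only through \<open>s\<close>, which is extremal at the foot. Equality propagates
  back to the equality case of the reversed Cauchy-Schwarz inequality.\<close>

lemma lorentz_between_normal_planes:
  assumes m: "m \<bullet>\<^sub>L m = 1" and n: "n \<bullet>\<^sub>L n = 1" and g: "m \<bullet>\<^sub>L n < -1"
    and f: "foot n m \<in> H3" and u: "u \<in> normal_plane m" and v: "v \<in> normal_plane n"
  shows "- (u \<bullet>\<^sub>L v) \<ge> - (m \<bullet>\<^sub>L n)"
    and "- (u \<bullet>\<^sub>L v) \<le> - (m \<bullet>\<^sub>L n) \<Longrightarrow> v = foot n m"
proof -
  define r s where "r = sqrt ((m \<bullet>\<^sub>L n)\<^sup>2 - 1)" and "s = m \<bullet>\<^sub>L v"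
  have gram: "(m \<bullet>\<^sub>L n)\<^sup>2 > 1"
    using g by (smt (verit) one_less_power power2_minus zero_less_numeral)
  have r: "r > 0" "r\<^sup>2 = (m \<bullet>\<^sub>L n)\<^sup>2 - 1"
    using gram by (simp_all add: r_def)
  have u': "u \<in> H3" "m \<bullet>\<^sub>L u = 0" and v': "v \<in> H3" "n \<bullet>\<^sub>L v = 0" "v \<bullet>\<^sub>L n = 0"
    using u v by (auto simp: normal_plane_def lorentz_commute)
  \<comment> \<open>The \<open>n\<close> term of the foot drops out on the plane of
    \<open>n\<close>, so comparison with the foot bounds \<open>s\<close>.\<close>
  have vf: "v \<bullet>\<^sub>L foot n m = s / r"
    by (simp add: foot_def lorentz_simps v' r_def s_def lorentz_commute[of n m] lorentz_commute[of v])
  then have s: "- s \<ge> r"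
    using reverse_Cauchy_Schwarz(1)[OF v'(1) f] r(1) by (simp add: divide_le_eq)
  define q where "q = sqrt (1 + s\<^sup>2)"
  have q: "q > 0" "q\<^sup>2 = 1 + s\<^sup>2"
    by (simp_all add: q_def add_pos_nonneg)
  \<comment> \<open>The normalised projection of \<open>v\<close> to the plane of \<open>m\<close>,
    the point of that plane nearest to \<open>v\<close>.\<close>
  define z where "z = (1 / q) *\<^sub>R (v - s *\<^sub>R m)"
  have uz: "u \<bullet>\<^sub>L z = (u \<bullet>\<^sub>L v) / q"
    using u' by (simp add: z_def lorentz_simps lorentz_commute[of u m])
  have "z \<bullet>\<^sub>L z = - ((1 + s\<^sup>2) / q\<^sup>2)"
    by (simp add: z_def lorentz_simps m H3_norm v' s_def lorentz_commute[of v m]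
        power2_eq_square add_divide_distrib diff_divide_distrib)
  then have "z \<bullet>\<^sub>L z = -1"
    using q(1) by (simp flip: q(2))
  moreover have "u \<bullet>\<^sub>L v < 0"
    using lorentz_neg[OF u'(1), of v] v'(1) by (simp add: H3_def)
  then have "z \<bullet>\<^sub>L u < 0"
    using uz q by (simp add: lorentz_commute[of z] divide_less_0_iff)
  ultimately have "z \<in> H3"
    using in_H3_if_lorentz_neg[of u z] u'(1) by (simp add: H3_def)
  then have uv: "- (u \<bullet>\<^sub>L v) \<ge> q"
    using reverse_Cauchy_Schwarz(1)[OF u'(1), of z] uz q by (simp add: field_simps)
  have "s\<^sup>2 \<ge> r\<^sup>2"
    using s r by (metis less_imp_le power2_minus power_mono)
  then have "q\<^sup>2 \<ge> (- (m \<bullet>\<^sub>L n))\<^sup>2"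
    using q r by simp
  then have qg: "q \<ge> - (m \<bullet>\<^sub>L n)"
    using q by (meson less_imp_le power2_le_imp_le)
  then show "- (u \<bullet>\<^sub>L v) \<ge> - (m \<bullet>\<^sub>L n)"
    using uv by simp
  assume "- (u \<bullet>\<^sub>L v) \<le> - (m \<bullet>\<^sub>L n)"
  then have "q = - (m \<bullet>\<^sub>L n)"
    using uv qg by simp
  then have "(- s)\<^sup>2 \<le> r\<^sup>2"
    using q r by simp
  then have "- s \<le> r"
    using r by (meson less_imp_le power2_le_imp_le)
  then have "- (v \<bullet>\<^sub>L foot n m) \<le> 1"
    unfolding vf using r(1) by (simp add: le_divide_eq)
  then show "v = foot n m"
    using reverse_Cauchy_Schwarz(2)[OF v'(1) f] by simp
qed

lemma shortest_arc_normal_planes: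
  assumes m: "m \<bullet>\<^sub>L m = 1" and n: "n \<bullet>\<^sub>L n = 1" and g: "m \<bullet>\<^sub>L n < -1"
    and x: "positive_vec x" "light_like x" "m \<bullet>\<^sub>L x < 0" "n \<bullet>\<^sub>L x < 0"
  shows "shortest_arc (normal_plane m) (normal_plane n) = segment (foot m n) (foot n m)"
    and "shortest_arc_length (normal_plane m) (normal_plane n) = arcosh (- (m \<bullet>\<^sub>L n))"
proof -
  have g': "n \<bullet>\<^sub>L m < -1"
    using g by (simp add: lorentz_commute)
  have gram: "(m \<bullet>\<^sub>L n)\<^sup>2 > 1"
    using g by (smt (verit) one_less_power power2_minus zero_less_numeral)
  have fm: "foot m n \<in> normal_plane m" and fn: "foot n m \<in> normal_plane n"
    using foot_in_normal_plane assms g' by blast+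
  then have fH: "foot m n \<in> H3" "foot n m \<in> H3"
    by (auto simp: normal_plane_def)
  have sub: "normal_plane m \<subseteq> H3" "normal_plane n \<subseteq> H3"
    by (auto simp: normal_plane_def)
  have ff: "foot m n \<bullet>\<^sub>L foot n m = m \<bullet>\<^sub>L n"
    by (rule foot_products[OF m n gram])
  have ge: "- (foot m n \<bullet>\<^sub>L foot n m) \<le> - (u \<bullet>\<^sub>L v)"
    if "u \<in> normal_plane m" "v \<in> normal_plane n" for u v
    using lorentz_between_normal_planes(1)[OF m n g fH(2) that] ff by simp
  \<comment> \<open>Uniqueness of the pair resolves the \<open>THE\<close> in
    \<open>shortest_arc\<close>. The preceding lemma pins down only the second point, so it is used
    again with the planes exchanged.\<close>
  have eq: "u = foot m n \<and> v = foot n m"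
    if "u \<in> normal_plane m" "v \<in> normal_plane n" "- (u \<bullet>\<^sub>L v) \<le> - (foot m n \<bullet>\<^sub>L foot n m)" for u v
  proof
    have le: "- (u \<bullet>\<^sub>L v) \<le> - (m \<bullet>\<^sub>L n)" "- (v \<bullet>\<^sub>L u) \<le> - (n \<bullet>\<^sub>L m)"
      using that(3) unfolding ff by (simp_all only: lorentz_commute)
    show "v = foot n m"
      by (rule lorentz_between_normal_planes(2)[OF m n g fH(2) that(1,2) le(1)])
    show "u = foot m n"
      by (rule lorentz_between_normal_planes(2)[OF n m g' fH(1) that(2,1) le(2)])
  qed
  show "shortest_arc_length (normal_plane m) (normal_plane n) = arcosh (- (m \<bullet>\<^sub>L n))"
    using shortest_arc_length_eqI[OF fm fn sub ge] ff by simp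
  show "shortest_arc (normal_plane m) (normal_plane n) = segment (foot m n) (foot n m)"
    unfolding shortest_arc_def
  proof (rule the_equality)
    show "\<exists>u\<in>normal_plane m. \<exists>v\<in>normal_plane n. segment (foot m n) (foot n m) = segment u v \<and>
        (\<forall>u'\<in>normal_plane m. \<forall>v'\<in>normal_plane n. hdist u v \<le> hdist u' v')"
      by (rule bexI[OF _ fm], rule bexI[OF _ fn])
        (use ge hdist_le_iff[OF fH] sub in \<open>auto simp: subset_iff\<close>)
  next
    fix s
    assume "\<exists>u\<in>normal_plane m. \<exists>v\<in>normal_plane n. s = segment u v \<and>
        (\<forall>u'\<in>normal_plane m. \<forall>v'\<in>normal_plane n. hdist u v \<le> hdist u' v')"
    then obtain u v where uv: "u \<in> normal_plane m" "v \<in> normal_plane n" "s = segment u v"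
      "hdist u v \<le> hdist (foot m n) (foot n m)"
      using fm fn by blast
    then have "u = foot m n \<and> v = foot n m"
      using eq[OF uv(1,2)] hdist_le_iff fH sub by (auto simp: subset_iff)
    with uv(3) show "s = segment (foot m n) (foot n m)"
      by simp
  qed
qed

text \<open>Between two points of \<open>H3\<close> the cone construction \<open>ray\<close> cuts
  out the finite arc. By the addition formula for cosh, equality in the triangle inequality reads
  \<open>p * q + A * B = r\<close>, where \<open>A\<close> and \<open>B\<close> are the hyperbolic
  sines of the two parts.\<close>

lemma segment_eq_ray:
  assumes u: "u \<in> H3" and v: "v \<in> H3"
  shows "segment u v = ray u v"
proof -
  define r where "r = - (u \<bullet>\<^sub>L v)"
  have r: "u \<bullet>\<^sub>L v = - r" "v \<bullet>\<^sub>L u = - r" "r \<ge> 1"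
    using reverse_Cauchy_Schwarz(1)[OF u v] by (simp_all add: r_def lorentz_commute)
  have nu: "u \<bullet>\<^sub>L u = -1" "v \<bullet>\<^sub>L v = -1"
    using u v by (simp_all add: H3_norm)
  have "hdist u w + hdist w v = hdist u v \<longleftrightarrow> (\<exists>s\<ge>0. \<exists>t\<ge>0. w = s *\<^sub>R u + t *\<^sub>R v)"
    if w: "w \<in> H3" for w
  proof -
    define p q where "p = - (u \<bullet>\<^sub>L w)" and "q = - (w \<bullet>\<^sub>L v)"
    have p: "u \<bullet>\<^sub>L w = - p" "w \<bullet>\<^sub>L u = - p" "p \<ge> 1" and q: "w \<bullet>\<^sub>L v = - q" "v \<bullet>\<^sub>L w = - q" "q \<ge> 1"
      using reverse_Cauchy_Schwarz(1)[OF u w] reverse_Cauchy_Schwarz(1)[OF w v]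
      by (simp_all add: p_def q_def lorentz_commute)
    have nw: "w \<bullet>\<^sub>L w = -1"
      using w by (simp add: H3_norm)
    define A B where "A = sqrt (p\<^sup>2 - 1)" and "B = sqrt (q\<^sup>2 - 1)"
    have AB0: "A \<ge> 0" "B \<ge> 0" and AB: "A\<^sup>2 = p\<^sup>2 - 1" "B\<^sup>2 = q\<^sup>2 - 1"
      using p q by (simp_all add: A_def B_def)
    have cosh_sum: "cosh (arcosh p + arcosh q) = p * q + A * B"
      using p q by (simp add: cosh_add sinh_arcosh_real A_def B_def)
    have hd: "hdist u w = arcosh p" "hdist w v = arcosh q" "hdist u v = arcosh r"
      by (simp_all add: hdist_def p q r)
    have "hdist u w + hdist w v = hdist u v \<longleftrightarrow> p * q + A * B = r"
    proof
      assume "hdist u w + hdist w v = hdist u v"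
      then have "cosh (arcosh p + arcosh q) = cosh (arcosh r)"
        by (simp add: hd)
      then show "p * q + A * B = r"
        using r by (simp add: cosh_sum)
    next
      assume "p * q + A * B = r"
      then have "arcosh (cosh (arcosh p + arcosh q)) = arcosh r"
        by (simp add: cosh_sum)
      then show "hdist u w + hdist w v = hdist u v"
        using p q by (simp add: hd arcosh_cosh_real)
    qed
    also have "\<dots> \<longleftrightarrow> (\<exists>s\<ge>0. \<exists>t\<ge>0. w = s *\<^sub>R u + t *\<^sub>R v)"
    proof
      assume eq: "p * q + A * B = r"
      \<comment> \<open>The vectors \<open>u - p *\<^sub>R w\<close> and
        \<open>v - q *\<^sub>R w\<close> are tangent at \<open>w\<close>, of lengths
        \<open>A\<close> and \<open>B\<close>. Scaled to equal length they are opposite exactly when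
        the triangle equality holds, so their sum \<open>z\<close> vanishes.\<close>
      define z where "z = B *\<^sub>R (u - p *\<^sub>R w) + A *\<^sub>R (v - q *\<^sub>R w)"
      have "z \<bullet>\<^sub>L w = 0"
        by (simp add: z_def lorentz_simps p q nw)
      moreover have "z \<bullet>\<^sub>L z = B\<^sup>2 * (p\<^sup>2 - 1) + A\<^sup>2 * (q\<^sup>2 - 1) + 2 * A * B * (p * q - r)"
        by (simp add: z_def lorentz_simps p q r nw nu power2_eq_square algebra_simps)
      then have "z \<bullet>\<^sub>L z = B\<^sup>2 * A\<^sup>2 + A\<^sup>2 * B\<^sup>2 - 2 * A * B * (A * B)"
        unfolding AB [symmetric] eq [symmetric] by simp
      then have "z \<bullet>\<^sub>L z = 0"
        by (simp add: power2_eq_square)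
      ultimately have "z = 0"
        using orthogonal_time_like_zero[of w z] nw by simp
      then have *: "(B * p + A * q) *\<^sub>R w = B *\<^sub>R u + A *\<^sub>R v"
        by (simp add: z_def algebra_simps)
      show "\<exists>s\<ge>0. \<exists>t\<ge>0. w = s *\<^sub>R u + t *\<^sub>R v"
      proof (cases "B * p + A * q = 0")
        \<comment> \<open>Division is impossible here, but \<open>B = 0\<close> identifies
          \<open>w\<close> with the endpoint \<open>v\<close>.\<close>
        case True
        have "B * p = 0"
          using True AB0 p q by (simp add: add_nonneg_eq_0_iff)
        then have "q\<^sup>2 = 1"
          using AB p by simp
        then have "q = 1"
          using q by (simp add: power2_eq_1_iff)
        then have "w = v"
          using reverse_Cauchy_Schwarz(2)[OF w v] q by simp
        then show ?thesis
          by (intro exI[of _ 0] conjI exI[of _ 1]) auto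
      next
        case False
        have D: "B * p + A * q \<ge> 0"
          using AB0 p q by simp
        have "w = (1 / (B * p + A * q)) *\<^sub>R ((B * p + A * q) *\<^sub>R w)"
          using False by simp
        also have "\<dots> = (B / (B * p + A * q)) *\<^sub>R u + (A / (B * p + A * q)) *\<^sub>R v"
          unfolding * by (simp add: scaleR_add_right)
        finally show ?thesis
          using D AB0 by (intro exI[of _ "B / (B * p + A * q)"] conjI
              exI[of _ "A / (B * p + A * q)"] divide_nonneg_nonneg)
      qed
    next
      assume "\<exists>s\<ge>0. \<exists>t\<ge>0. w = s *\<^sub>R u + t *\<^sub>R v"
      then obtain s t where st: "s \<ge> 0" "t \<ge> 0" and w_eq: "w = s *\<^sub>R u + t *\<^sub>R v"
        by blast
      have p': "p = s + t * r"
        by (simp add: p_def w_eq lorentz_simps nu r)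
      have q': "q = s * r + t"
        by (simp add: q_def w_eq lorentz_simps nu r)
      have one: "1 = s\<^sup>2 + t\<^sup>2 + 2 * s * t * r"
        using nw by (simp add: w_eq lorentz_simps nu r power2_eq_square algebra_simps)
      have r2: "r\<^sup>2 - 1 \<ge> 0"
        using r by simp
      \<comment> \<open>The relation \<open>w \<bullet>\<^sub>L w = -1\<close> makes the two
        hyperbolic sines the multiples by \<open>t\<close> and \<open>s\<close> of that of the whole
        arc.\<close>
      have "p\<^sup>2 - 1 = t\<^sup>2 * (r\<^sup>2 - 1)" "q\<^sup>2 - 1 = s\<^sup>2 * (r\<^sup>2 - 1)"
        using one by (simp_all add: p' q' power2_eq_square algebra_simps)
      then have "A * B = t * s * (r\<^sup>2 - 1)"
        using st r2 by (simp add: A_def B_def real_sqrt_mult)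
      then have "p * q + A * B = r * (s\<^sup>2 + t\<^sup>2 + 2 * s * t * r)"
        by (simp add: p' q' power2_eq_square algebra_simps)
      then show "p * q + A * B = r"
        using one by simp
    qed
    finally show ?thesis .
  qed
  then show ?thesis
    by (auto simp: segment_def ray_def)
qed

section \<open>Rays to an ideal point and horoballs\<close>

text \<open>For uniqueness, the tangent of a competing geodesic at its foot is orthogonal to the
  plane, hence a multiple of \<open>n\<close>. Its subspace thus contains both \<open>n\<close> and
  \<open>x\<close>, and the dimensions agree.\<close>

lemma perp_geodesic_to_normal_plane:
  assumes n: "n \<bullet>\<^sub>L n = 1" and x: "positive_vec x" "light_like x" "n \<bullet>\<^sub>L x < 0"
  shows "perp_geodesic_to (normal_plane n) x = span {n, x} \<inter> H3"
proof -
  define y where "y = - (n \<bullet>\<^sub>L x)"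
  have y: "y > 0" "n \<bullet>\<^sub>L x = - y" "x \<bullet>\<^sub>L n = - y"
    using x by (simp_all add: y_def lorentz_commute)
  have xx: "x \<bullet>\<^sub>L x = 0"
    using x by (simp add: light_like_def)
  define p where "p = n + (1 / y) *\<^sub>R x"
  have pp: "p \<bullet>\<^sub>L p = -1" and np: "n \<bullet>\<^sub>L p = 0"
    using y by (simp_all add: p_def lorentz_simps n xx)
  have "p \<bullet>\<^sub>L x < 0"
    using y by (simp add: p_def lorentz_simps xx)
  then have pH: "p \<in> H3"
    using in_H3_if_lorentz_neg[of x p] x xx pp by simp
  have pV: "p \<in> span {n, x}"
    unfolding p_def by (intro span_add span_scale span_base) auto
  have sp: "span (span {n, x} \<inter> H3) = span {n, x}"
    using span_Int_H3[OF subspace_span pV] pp by simp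
  have n_notin: "n \<notin> span {x}"
    using n xx by (auto simp: span_singleton lorentz_simps)
  have "independent {n, x}"
    using n_notin x by (simp add: independent_insert light_like_def)
  moreover have "card {n, x} = 2"
    using n_notin by (auto simp: card_insert_if span_base)
  ultimately have dim: "dim {n, x} = 2"
    using dim_eq_card_independent by fastforce
  show ?thesis
    unfolding perp_geodesic_to_def
  proof (rule the_equality, intro conjI)
    show "is_geodesic (span {n, x} \<inter> H3)"
      unfolding is_geodesic_def
    proof (intro exI[of _ "span {n, x}"] conjI bexI[of _ p])
      show "time_like p"
        using pp by (auto simp: time_like_def lorentz_simps)
    qed (use pV dim in simp_all)
    show "x \<in> ideal_boundary (span {n, x} \<inter> H3)"
      using x by (simp add: ideal_boundary_def sp span_base)
    show "geodesic_perp_plane (span {n, x} \<inter> H3) (normal_plane n)"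
      unfolding geodesic_perp_plane_def sp span_normal_plane[OF n]
    proof (intro bexI[of _ p] ballI impI)
      show "p \<in> span {n, x} \<inter> H3 \<inter> normal_plane n"
        using pV pH np by (simp add: normal_plane_def)
      fix v w assume v: "v \<in> span {n, x}" "v \<bullet>\<^sub>L p = 0" and w: "w \<in> {v. n \<bullet>\<^sub>L v = 0}"
      obtain \<alpha> \<beta> where "v = \<alpha> *\<^sub>R n + \<beta> *\<^sub>R x"
        using v(1) by (auto simp: span_insert span_singleton algebra_simps)
      then have "\<beta> = 0" "v = \<alpha> *\<^sub>R n + \<beta> *\<^sub>R x"
        using v(2) y by (simp_all add: p_def lorentz_simps n xx)
      then show "v \<bullet>\<^sub>L w = 0"
        using w by (simp add: lorentz_simps)
    qed
  next
    fix G assume G: "is_geodesic G \<and> geodesic_perp_plane G (normal_plane n) \<and> x \<in> ideal_boundary G"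
    then obtain V t where V: "subspace V" "dim V = 2" "t \<in> V" "time_like t" and G_eq: "G = V \<inter> H3"
      by (auto simp: is_geodesic_def)
    have spG: "span G = V"
      using span_Int_H3[OF V(1,3)] V(4) by (simp add: G_eq time_like_def)
    have xV: "x \<in> V"
      using G by (simp add: ideal_boundary_def spG)
    obtain p' where p': "p' \<in> G" "p' \<in> normal_plane n" and
      perp: "\<And>v w. v \<in> V \<Longrightarrow> n \<bullet>\<^sub>L w = 0 \<Longrightarrow> v \<bullet>\<^sub>L p' = 0 \<Longrightarrow> w \<bullet>\<^sub>L p' = 0 \<Longrightarrow> v \<bullet>\<^sub>L w = 0"
      using G unfolding geodesic_perp_plane_def by (auto simp: spG span_normal_plane[OF n])
    have p'V: "p' \<in> V" and p'p': "p' \<bullet>\<^sub>L p' = -1" and np': "n \<bullet>\<^sub>L p' = 0"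
      using p' by (auto simp: G_eq normal_plane_def H3_norm)
    \<comment> \<open>The projection of \<open>x\<close> to the tangent space at \<open>p'\<close>,
      tangent to the geodesic.\<close>
    define v where "v = x + (x \<bullet>\<^sub>L p') *\<^sub>R p'"
    have v: "v \<in> V" "v \<bullet>\<^sub>L p' = 0"
      using xV p'V V(1) by (simp_all add: v_def subspace_add subspace_scale lorentz_simps p'p')
    \<comment> \<open>The part of \<open>v\<close> tangent to the plane; perpendicularity makes its
      square zero.\<close>
    define w where "w = v - (v \<bullet>\<^sub>L n) *\<^sub>R n"
    have w: "n \<bullet>\<^sub>L w = 0" "w \<bullet>\<^sub>L p' = 0"
      by (simp_all add: w_def lorentz_simps n v np' lorentz_commute[of n v])
    have "v \<bullet>\<^sub>L w = 0"
      using perp v w by blast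
    then have "w \<bullet>\<^sub>L w = 0"
      using w by (simp add: w_def lorentz_simps n)
    then have "w = 0"
      using orthogonal_time_like_zero[of p' w] w p'p' by simp
    then have vn: "v = (v \<bullet>\<^sub>L n) *\<^sub>R n"
      by (simp add: w_def)
    have vn': "v \<bullet>\<^sub>L n = - y"
      using np' y by (simp add: v_def lorentz_simps lorentz_commute[of p'])
    have "n = (- 1 / y) *\<^sub>R v"
      using vn y by (simp add: vn')
    then have "n \<in> V"
      using v(1) V(1) by (metis subspace_scale)
    then have "span {n, x} \<subseteq> V"
      using xV V(1) by (intro span_minimal) auto
    then have "span {n, x} = V"
      using V dim by (intro subspace_dim_equal) auto
    then show "G = span {n, x} \<inter> H3"
      by (simp add: G_eq)
  qed
qed

text \<open>The multiple of \<open>x\<close> is chosen to cancel the product with \<open>n\<close>: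
  this is where the perpendicular geodesic towards \<open>x\<close> crosses the plane, and also the
  point of the plane nearest to the horoball.\<close>

definition ideal_foot :: "real^4 \<Rightarrow> real^4 \<Rightarrow> real^4" where
  "ideal_foot n x = n - (1 / (n \<bullet>\<^sub>L x)) *\<^sub>R x"

lemma ideal_foot_in_normal_plane:
  assumes n: "n \<bullet>\<^sub>L n = 1" and x: "positive_vec x" "light_like x" "n \<bullet>\<^sub>L x < 0"
  shows "ideal_foot n x \<in> normal_plane n" "ideal_foot n x \<bullet>\<^sub>L x = n \<bullet>\<^sub>L x"
proof -
  have xx: "x \<bullet>\<^sub>L x = 0"
    using x by (simp add: light_like_def)
  show fx: "ideal_foot n x \<bullet>\<^sub>L x = n \<bullet>\<^sub>L x"
    by (simp add: ideal_foot_def lorentz_simps xx)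
  have "ideal_foot n x \<bullet>\<^sub>L ideal_foot n x = -1"
    using x by (simp add: ideal_foot_def lorentz_simps n xx lorentz_commute[of x n])
  moreover have "n \<bullet>\<^sub>L ideal_foot n x = 0"
    using x by (simp add: ideal_foot_def lorentz_simps n)
  ultimately show "ideal_foot n x \<in> normal_plane n"
    using in_H3_if_lorentz_neg[of x "ideal_foot n x"] x xx fx by (simp add: normal_plane_def)
qed

text \<open>Orthogonality to \<open>n\<close> cuts \<open>span {n, x}\<close> down to one line,
  which meets \<open>H3\<close> once; this fixes the starting point of the ray.\<close>

lemma perp_ray_to_normal_plane:
  assumes n: "n \<bullet>\<^sub>L n = 1" and x: "positive_vec x" "light_like x" "n \<bullet>\<^sub>L x < 0"
  shows "perp_ray_to (normal_plane n) x = ray (ideal_foot n x) x"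
proof -
  have fP: "ideal_foot n x \<in> normal_plane n"
    using ideal_foot_in_normal_plane[OF assms] by simp
  have fV: "ideal_foot n x \<in> span {n, x}"
    unfolding ideal_foot_def by (intro span_diff span_scale span_base) auto
  have "p = ideal_foot n x" if p: "p \<in> span {n, x}" "p \<in> normal_plane n" for p
  proof -
    obtain \<alpha> \<beta> where ab: "p = \<alpha> *\<^sub>R n + \<beta> *\<^sub>R x"
      using p(1) by (auto simp: span_insert span_singleton algebra_simps)
    have "\<alpha> + \<beta> * (n \<bullet>\<^sub>L x) = 0"
      using p(2) by (simp add: ab normal_plane_def lorentz_simps n)
    then have "\<beta> = - \<alpha> / (n \<bullet>\<^sub>L x)"
      using x by (simp add: field_simps)
    then have pa: "p = \<alpha> *\<^sub>R ideal_foot n x"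
      by (simp add: ab ideal_foot_def algebra_simps)
    have H: "ideal_foot n x \<in> H3" "\<alpha> *\<^sub>R ideal_foot n x \<in> H3"
      using p(2) fP pa by (simp_all add: normal_plane_def)
    have "\<alpha> * \<alpha> = 1"
      using H3_norm[OF H(1)] H3_norm[OF H(2)] by (simp add: lorentz_simps)
    then have "\<alpha> = 1 \<or> \<alpha> = -1"
      by (simp add: square_eq_1_iff)
    moreover have "\<alpha> * (ideal_foot n x $ 1) > 0"
      using H3_positive[OF H(2)] by simp
    ultimately have "\<alpha> = 1"
      using H3_positive[OF H(1)] by auto
    with pa show ?thesis
      by simp
  qed
  then have "perp_geodesic_to (normal_plane n) x \<inter> normal_plane n = {ideal_foot n x}"
    unfolding perp_geodesic_to_normal_plane[OF assms] using fP fV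
    unfolding normal_plane_def by blast
  then show ?thesis
    by (simp add: perp_ray_to_def)
qed

section \<open>Signed distances from points and planes to a horoball\<close>

lemma arcosh_mean_exp:
  fixes q :: real
  assumes "q > 0"
  shows "arcosh ((q + 1 / q) / 2) = \<bar>ln q\<bar>"
proof -
  have "cosh \<bar>ln q\<bar> = (q + 1 / q) / 2"
    using assms by (simp add: cosh_ln_real inverse_eq_divide)
  then show ?thesis
    by (metis abs_ge_zero arcosh_cosh_real)
qed

text \<open>The nearest horosphere point lies on the geodesic from \<open>v\<close> towards
  \<open>x\<close>, at distance \<open>\<bar>ln q\<bar>\<close>. The horoball is given by
  \<open>q \<le> 1\<close>, so the sign convention removes the absolute value.\<close>

lemma signed_dist_horoball_eq:
  assumes v: "v \<in> H3" and x: "positive_vec x" "light_like x"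
  shows "signed_dist_horoball x v = ln (- (v \<bullet>\<^sub>L x))"
proof -
  define q where "q = - (v \<bullet>\<^sub>L x)"
  have xx: "x \<bullet>\<^sub>L x = 0"
    using x by (simp add: light_like_def)
  have q: "q > 0" "v \<bullet>\<^sub>L x = - q" "x \<bullet>\<^sub>L v = - q"
    using lorentz_neg[OF v x(1)] xx by (simp_all add: q_def lorentz_commute)
  have vv: "v \<bullet>\<^sub>L v = -1"
    using v by (rule H3_norm)
  \<comment> \<open>The coefficient \<open>1 / q\<close> puts \<open>s\<close> on the horosphere,
    and \<beta> normalises its square to -1.\<close>
  define \<beta> where "\<beta> = (1 - 1 / q\<^sup>2) / 2"
  define s where "s = (1 / q) *\<^sub>R v + \<beta> *\<^sub>R x"
  have ss: "s \<bullet>\<^sub>L s = -1" and sx: "s \<bullet>\<^sub>L x = -1"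
    using q by (simp_all add: s_def lorentz_simps vv xx \<beta>_def field_simps power2_eq_square)
  have sH: "s \<in> H3"
    using in_H3_if_lorentz_neg[of x s] x xx ss sx by simp
  have vs: "- (v \<bullet>\<^sub>L s) = (q + 1 / q) / 2"
    using q by (simp add: s_def lorentz_simps vv \<beta>_def field_simps power2_eq_square)
  have "(INF t\<in>horosphere x. hdist v t) = hdist v s"
  proof (rule cInf_eq_minimum)
    show "hdist v s \<in> hdist v ` horosphere x"
      using sH sx by (simp add: horosphere_def)
    fix l assume "l \<in> hdist v ` horosphere x"
    then obtain t where t: "t \<in> H3" "t \<bullet>\<^sub>L x = -1" "l = hdist v t"
      by (auto simp: horosphere_def)
    \<comment> \<open>On the horosphere the \<open>x\<close> part of this expansion contributes a
      constant, so only the product with \<open>s\<close> remains to be bounded.\<close>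
    have "v = q *\<^sub>R s - (\<beta> * q) *\<^sub>R x"
      using q by (simp add: s_def algebra_simps)
    then have "- (v \<bullet>\<^sub>L t) = q * (- (s \<bullet>\<^sub>L t)) - \<beta> * q"
      using t by (simp add: lorentz_simps lorentz_commute[of x t])
    moreover have "q * (- (s \<bullet>\<^sub>L t)) \<ge> q * 1"
      using reverse_Cauchy_Schwarz(1)[OF sH t(1)] q by (intro mult_left_mono) auto
    moreover have "q - \<beta> * q = (q + 1 / q) / 2"
      using q by (simp add: \<beta>_def field_simps power2_eq_square)
    ultimately have "- (v \<bullet>\<^sub>L s) \<le> - (v \<bullet>\<^sub>L t)"
      unfolding vs by linarith
    then show "hdist v s \<le> l"
      using hdist_le_iff[OF v sH v t(1)] t(3) by simp
  qed
  also have "\<dots> = \<bar>ln q\<bar>"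
    unfolding hdist_def vs by (rule arcosh_mean_exp[OF q(1)])
  finally show ?thesis
    using q v by (auto simp: signed_dist_horoball_def horoball_def)
qed

text \<open>Writing \<open>x\<close> through \<open>n\<close> and \<open>ideal_foot n x\<close>
  shows that on the plane \<open>- (p \<bullet>\<^sub>L x)\<close> is
  \<open>- (n \<bullet>\<^sub>L x)\<close> times the hyperbolic cosine of the distance from
  \<open>p\<close> to the foot.\<close>

lemma plane_horoball_dist_normal_plane:
  assumes n: "n \<bullet>\<^sub>L n = 1" and x: "positive_vec x" "light_like x" "n \<bullet>\<^sub>L x < 0"
  shows "plane_horoball_dist (normal_plane n) x = ln (- (n \<bullet>\<^sub>L x))"
  unfolding plane_horoball_dist_def
proof (rule Least_equality)
  note f = ideal_foot_in_normal_plane[OF assms]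
  have fH: "ideal_foot n x \<in> H3"
    using f by (simp add: normal_plane_def)
  show "\<exists>p\<in>normal_plane n. ln (- (n \<bullet>\<^sub>L x)) = signed_dist_horoball x p"
    using f signed_dist_horoball_eq[OF fH x(1,2)] by (intro bexI[of _ "ideal_foot n x"]) auto
  fix h assume "\<exists>p\<in>normal_plane n. h = signed_dist_horoball x p"
  then obtain p where p: "p \<in> H3" "n \<bullet>\<^sub>L p = 0" "h = signed_dist_horoball x p"
    by (auto simp: normal_plane_def)
  have "x = (n \<bullet>\<^sub>L x) *\<^sub>R n - (n \<bullet>\<^sub>L x) *\<^sub>R ideal_foot n x"
    using x by (simp add: ideal_foot_def algebra_simps)
  then have "p \<bullet>\<^sub>L x = (n \<bullet>\<^sub>L x) * (p \<bullet>\<^sub>L n) - (n \<bullet>\<^sub>L x) * (p \<bullet>\<^sub>L ideal_foot n x)"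
    by (metis lorentz_simps(4,6))
  then have "- (p \<bullet>\<^sub>L x) = - (n \<bullet>\<^sub>L x) * (- (p \<bullet>\<^sub>L ideal_foot n x))"
    using p by (simp add: lorentz_commute[of p n])
  moreover have "- (n \<bullet>\<^sub>L x) * (- (p \<bullet>\<^sub>L ideal_foot n x)) \<ge> - (n \<bullet>\<^sub>L x) * 1"
    using reverse_Cauchy_Schwarz(1)[OF p(1) fH] x by (intro mult_left_mono) auto
  ultimately have "- (p \<bullet>\<^sub>L x) \<ge> - (n \<bullet>\<^sub>L x)"
    by simp
  then show "ln (- (n \<bullet>\<^sub>L x)) \<le> h"
    using x signed_dist_horoball_eq[OF p(1) x(1,2)] p(3) by simp
qed

text \<open>The norm condition eliminates \<open>t\<close>, leaving the one-variable function
  \<open>s * (A + e) + e / s\<close>, which the arithmetic-geometric mean inequality minimises;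
  \<open>F\<close> is the square of the minimum.\<close>

lemma ray_to_ideal_point_min:
  assumes n: "n \<bullet>\<^sub>L n = 1" and x: "positive_vec x" "light_like x" "n \<bullet>\<^sub>L x < 0"
    and w: "w \<in> H3" "w \<bullet>\<^sub>L n \<le> 0"
  defines "F \<equiv> (w \<bullet>\<^sub>L x) / (n \<bullet>\<^sub>L x) * ((w \<bullet>\<^sub>L x) / (n \<bullet>\<^sub>L x) - 2 * (w \<bullet>\<^sub>L n))"
  shows "r \<in> ray (ideal_foot n x) x \<Longrightarrow> sqrt F \<le> - (w \<bullet>\<^sub>L r)"
    and "\<exists>r \<in> ray (ideal_foot n x) x. - (w \<bullet>\<^sub>L r) = sqrt F"
proof -
  define y C A e where "y = - (n \<bullet>\<^sub>L x)" and "C = - (w \<bullet>\<^sub>L x)" and "A = - (w \<bullet>\<^sub>L n)"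
    and "e = C / (2 * y)"
  have xx: "x \<bullet>\<^sub>L x = 0"
    using x by (simp add: light_like_def)
  have y: "y > 0" "n \<bullet>\<^sub>L x = - y"
    using x by (simp_all add: y_def)
  have C: "C > 0" "w \<bullet>\<^sub>L x = - C"
    using lorentz_neg[OF w(1) x(1)] xx by (simp_all add: C_def)
  have A: "A \<ge> 0" "w \<bullet>\<^sub>L n = - A"
    using w by (simp_all add: A_def)
  have e: "e > 0" "C / y = 2 * e"
    using C y by (simp_all add: e_def)
  have F: "F = 4 * (e * (A + e))"
    using y by (simp add: F_def y C A e(2) algebra_simps)
  let ?p = "ideal_foot n x"
  note f = ideal_foot_in_normal_plane[OF n x]
  have wp: "w \<bullet>\<^sub>L ?p = - (A + 2 * e)"
    using e(2) by (simp add: ideal_foot_def lorentz_simps C y A)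
  have rr: "(s *\<^sub>R ?p + t *\<^sub>R x) \<bullet>\<^sub>L (s *\<^sub>R ?p + t *\<^sub>R x) = - s\<^sup>2 - 2 * s * t * y" for s t
    using f y by (simp add: lorentz_simps xx H3_norm normal_plane_def lorentz_commute[of x ?p]
        power2_eq_square algebra_simps)
  have val: "- (w \<bullet>\<^sub>L (s *\<^sub>R ?p + t *\<^sub>R x)) = s * (A + e) + e / s"
    if "s > 0" "s\<^sup>2 + 2 * s * t * y = 1" for s t
  proof -
    have "t = (1 - s\<^sup>2) / (2 * s * y)"
      using that y by (simp add: field_simps)
    then have "t * C = (1 - s\<^sup>2) / (2 * s * y) * C"
      by simp
    also have "\<dots> = e / s - e * s"
      using that(1) y(1) by (simp add: e_def field_simps power2_eq_square)
    finally have "t * C = e / s - e * s" .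
    then show ?thesis
      by (simp add: lorentz_simps wp C algebra_simps)
  qed
  show "sqrt F \<le> - (w \<bullet>\<^sub>L r)" if r: "r \<in> ray ?p x"
  proof -
    obtain s t where st: "s \<ge> 0" "t \<ge> 0" "r = s *\<^sub>R ?p + t *\<^sub>R x" "r \<in> H3"
      using r unfolding ray_def by blast
    have one: "s\<^sup>2 + 2 * s * t * y = 1"
      using H3_norm[OF st(4)] rr[of s t] by (simp add: st(3))
    then have s: "s > 0"
      using st by (cases "s = 0") auto
    have "(s * (A + e) + e / s)\<^sup>2 - F = (s * (A + e) - e / s)\<^sup>2"
      using s by (simp add: F power2_eq_square field_simps)
    then have "F \<le> (s * (A + e) + e / s)\<^sup>2"
      by (metis diff_ge_0_iff_ge zero_le_power2)
    then show ?thesis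
      unfolding st(3) val[OF s one] using s A e by (intro real_le_lsqrt) auto
  qed
  \<comment> \<open>The equality case of the mean inequality, where
    \<open>s * (A + e) = e / s\<close>.\<close>
  define s where "s = sqrt (e / (A + e))"
  have s: "s > 0" "s\<^sup>2 = e / (A + e)"
    using A e by (simp_all add: s_def)
  define t where "t = (1 - s\<^sup>2) / (2 * s * y)"
  \<comment> \<open>Here \<open>A \<ge> 0\<close> gives \<open>s\<^sup>2 \<le> 1\<close>, so the
    minimiser lies on the ray and not on its extension beyond the plane.\<close>
  have t: "t \<ge> 0"
    using A e s y by (simp add: t_def)
  have one: "s\<^sup>2 + 2 * s * t * y = 1"
    using s(1) y by (simp add: t_def field_simps)
  have "s *\<^sub>R ?p + t *\<^sub>R x \<in> H3"
  proof (rule in_H3_if_lorentz_neg)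
    show "(s *\<^sub>R ?p + t *\<^sub>R x) \<bullet>\<^sub>L x < 0"
      using s y f by (simp add: lorentz_simps xx mult_pos_neg)
  qed (use x xx rr one in auto)
  then have "s *\<^sub>R ?p + t *\<^sub>R x \<in> ray ?p x"
    using s t by (auto simp: ray_def intro: less_imp_le)
  moreover have "s * (A + e) + e / s = sqrt F"
  proof -
    have "e = s\<^sup>2 * (A + e)"
      using s A e by simp
    then have "e / s = s * (A + e)"
      using s(1) by (simp add: field_simps power2_eq_square)
    moreover have "F = (2 * (s * (A + e)))\<^sup>2"
      using \<open>e = s\<^sup>2 * (A + e)\<close> unfolding F by (simp add: power2_eq_square)
    then have "sqrt F = 2 * (s * (A + e))"
      using s A e by (intro real_sqrt_unique) auto
    ultimately show ?thesis
      by simp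
  qed
  ultimately show "\<exists>r \<in> ray ?p x. - (w \<bullet>\<^sub>L r) = sqrt F"
    using val[OF s(1) one] by (intro bexI[of _ "s *\<^sub>R ?p + t *\<^sub>R x"]) auto
qed

text \<open>The coefficients are confined to a closed part of the unit square, because all terms of
  \<open>s\<^sup>2 + t\<^sup>2 + 2 * s * t * r = 1\<close> are nonnegative. This will provide a
  minimum over the internal edge.\<close>

lemma compact_ray:
  assumes u: "u \<in> H3" and v: "v \<in> H3"
  shows "compact (ray u v)"
proof -
  define r where "r = - (u \<bullet>\<^sub>L v)"
  have r: "u \<bullet>\<^sub>L v = - r" "v \<bullet>\<^sub>L u = - r" "r \<ge> 1"
    using reverse_Cauchy_Schwarz(1)[OF u v] by (simp_all add: r_def lorentz_commute)
  have nu: "u \<bullet>\<^sub>L u = -1" "v \<bullet>\<^sub>L v = -1"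
    using u v by (simp_all add: H3_norm)
  define K where "K = ({0..1} \<times> {0..1}) \<inter> {z. (fst z)\<^sup>2 + (snd z)\<^sup>2 + 2 * fst z * snd z * r = (1::real)}"
  have K: "compact K"
    unfolding K_def
    by (intro compact_Int_closed compact_Times compact_Icc closed_Collect_eq continuous_intros)
  have ww: "(s *\<^sub>R u + t *\<^sub>R v) \<bullet>\<^sub>L (s *\<^sub>R u + t *\<^sub>R v) = - (s\<^sup>2 + t\<^sup>2 + 2 * s * t * r)" for s t
    by (simp add: lorentz_simps nu r power2_eq_square algebra_simps)
  have "ray u v = (\<lambda>z. fst z *\<^sub>R u + snd z *\<^sub>R v) ` K"
  proof (intro equalityI subsetI)
    fix w assume "w \<in> ray u v"
    then obtain s t where st: "s \<ge> 0" "t \<ge> 0" "w = s *\<^sub>R u + t *\<^sub>R v" "w \<in> H3"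
      unfolding ray_def by blast
    have one: "s\<^sup>2 + t\<^sup>2 + 2 * s * t * r = 1"
      using H3_norm[OF st(4)] ww[of s t] by (simp add: st(3))
    have "2 * s * t * r \<ge> 0"
      using st r by simp
    then have "s\<^sup>2 \<le> 1" "t\<^sup>2 \<le> 1"
      using one zero_le_power2[of s] zero_le_power2[of t] by linarith+
    then have "s \<le> 1" "t \<le> 1"
      using st by (simp_all add: power_le_one_iff abs_square_le_1)
    then have "(s, t) \<in> K"
      using one st by (simp add: K_def)
    then show "w \<in> (\<lambda>z. fst z *\<^sub>R u + snd z *\<^sub>R v) ` K"
      using st(3) by (intro image_eqI[of _ _ "(s, t)"]) auto
  next
    fix w assume "w \<in> (\<lambda>z. fst z *\<^sub>R u + snd z *\<^sub>R v) ` K"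
    then obtain s t where st: "s \<ge> 0" "t \<ge> 0" "w = s *\<^sub>R u + t *\<^sub>R v"
      and one: "s\<^sup>2 + t\<^sup>2 + 2 * s * t * r = 1"
      by (auto simp: K_def)
    have "s \<noteq> 0 \<or> t \<noteq> 0"
      using one by auto
    then have "s * u $ 1 + t * v $ 1 > 0"
      using st H3_positive[OF u] H3_positive[OF v]
      by (metis add_nonneg_pos add_pos_nonneg less_eq_real_def mult_nonneg_nonneg mult_pos_pos)
    then have "w \<in> H3"
      using ww[of s t] one by (simp add: st(3) H3_def positive_vec_def)
    then show "w \<in> ray u v"
      using st by (auto simp: ray_def)
  qed
  moreover have "compact ((\<lambda>z. fst z *\<^sub>R u + snd z *\<^sub>R v) ` K)"
    using K by (intro compact_continuous_image continuous_intros)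
  ultimately show ?thesis
    by simp
qed

section \<open>The transversal\<close>

text \<open>Both feet have nonnegative coordinates with respect to \<open>m\<close> and
  \<open>n\<close>, so every point of the edge does too; these coordinates make products with the
  other Gram vectors linear.\<close>

lemma segment_between_feet:
  assumes m: "m \<bullet>\<^sub>L m = 1" and n: "n \<bullet>\<^sub>L n = 1" and g: "m \<bullet>\<^sub>L n < -1"
    and x: "positive_vec x" "light_like x" "m \<bullet>\<^sub>L x < 0" "n \<bullet>\<^sub>L x < 0"
  defines "S \<equiv> segment (foot m n) (foot n m)" and "\<mu> \<equiv> sqrt (1 / (2 * (- (m \<bullet>\<^sub>L n) - 1)))"
  shows "compact S" "S \<subseteq> H3"
    and "w \<in> S \<Longrightarrow> \<exists>\<sigma>\<ge>0. \<exists>\<tau>\<ge>0. w = \<sigma> *\<^sub>R m + \<tau> *\<^sub>R n \<and> (\<sigma> + \<tau>)\<^sup>2 \<ge> 2 / (- (m \<bullet>\<^sub>L n) - 1)"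
    and "\<mu> *\<^sub>R m + \<mu> *\<^sub>R n \<in> S"
proof -
  define X r where "X = - (m \<bullet>\<^sub>L n)" and "r = sqrt (X\<^sup>2 - 1)"
  have X: "X > 1" "m \<bullet>\<^sub>L n = - X" "n \<bullet>\<^sub>L m = - X"
    using g by (simp_all add: X_def lorentz_commute)
  have r: "r > 0" "r\<^sup>2 = X\<^sup>2 - 1"
    using X by (simp_all add: r_def one_less_power)
  have fH: "foot m n \<in> H3" "foot n m \<in> H3"
    using foot_in_normal_plane[OF m n g x] foot_in_normal_plane[OF n m _ x(1,2,4,3)] g
    by (auto simp: normal_plane_def lorentz_commute[of n m])
  have S: "S = ray (foot m n) (foot n m)"
    unfolding S_def by (rule segment_eq_ray[OF fH])
  have f: "foot m n = (X / r) *\<^sub>R m + (1 / r) *\<^sub>R n" "foot n m = (1 / r) *\<^sub>R m + (X / r) *\<^sub>R n"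
    by (simp_all add: foot_def X r_def algebra_simps)
  show "compact S"
    unfolding S by (rule compact_ray[OF fH])
  show "S \<subseteq> H3"
    by (auto simp: S ray_def)
  have ww: "(\<sigma> *\<^sub>R m + \<tau> *\<^sub>R n) \<bullet>\<^sub>L (\<sigma> *\<^sub>R m + \<tau> *\<^sub>R n) = \<sigma>\<^sup>2 + \<tau>\<^sup>2 - 2 * \<sigma> * \<tau> * X" for \<sigma> \<tau>
    by (simp add: lorentz_simps m n X power2_eq_square algebra_simps)
  show "\<exists>\<sigma>\<ge>0. \<exists>\<tau>\<ge>0. w = \<sigma> *\<^sub>R m + \<tau> *\<^sub>R n \<and> (\<sigma> + \<tau>)\<^sup>2 \<ge> 2 / (- (m \<bullet>\<^sub>L n) - 1)"
    if w: "w \<in> S"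
  proof -
    obtain s t where st: "s \<ge> 0" "t \<ge> 0" "w = s *\<^sub>R foot m n + t *\<^sub>R foot n m" and wH: "w \<in> H3"
      using w by (auto simp: S ray_def)
    define \<sigma> \<tau> where "\<sigma> = s * X / r + t / r" and "\<tau> = s / r + t * X / r"
    have w_eq: "w = \<sigma> *\<^sub>R m + \<tau> *\<^sub>R n"
      by (simp add: st f \<sigma>_def \<tau>_def algebra_simps)
    have "\<sigma>\<^sup>2 + \<tau>\<^sup>2 - 2 * \<sigma> * \<tau> * X = -1"
      using H3_norm[OF wH] unfolding w_eq ww .
    \<comment> \<open>In terms of sum and difference the norm condition shows that the sum is least
      at \<sigma> = \<tau>.\<close>
    then have "(\<sigma> + \<tau>)\<^sup>2 * (X - 1) = 2 + (X + 1) * (\<sigma> - \<tau>)\<^sup>2"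
      by (simp add: power2_eq_square algebra_simps)
    moreover have "(X + 1) * (\<sigma> - \<tau>)\<^sup>2 \<ge> 0"
      using X by simp
    ultimately have "(\<sigma> + \<tau>)\<^sup>2 \<ge> 2 / (X - 1)"
      using X by (simp add: divide_le_eq)
    moreover have "\<sigma> \<ge> 0" "\<tau> \<ge> 0"
      using st X r by (simp_all add: \<sigma>_def \<tau>_def)
    ultimately show ?thesis
      using w_eq by (auto simp: X_def)
  qed
  \<comment> \<open>The common coordinate of the midpoint, from setting \<sigma> = \<tau> in the
    norm condition.\<close>
  have \<mu>: "\<mu> > 0" "\<mu>\<^sup>2 = 1 / (2 * (X - 1))"
    using X by (simp_all add: \<mu>_def)
  let ?w = "\<mu> *\<^sub>R m + \<mu> *\<^sub>R n"
  have "?w \<bullet>\<^sub>L ?w = - (\<mu>\<^sup>2 * (2 * (X - 1)))"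
    by (simp add: ww power2_eq_square algebra_simps)
  then have "?w \<bullet>\<^sub>L ?w = -1"
    using X \<mu> by simp
  moreover have "?w \<bullet>\<^sub>L x < 0"
    using x \<mu> by (simp add: lorentz_simps add_neg_neg mult_pos_neg)
  ultimately have wH: "?w \<in> H3"
    using in_H3_if_lorentz_neg[of x ?w] x by (simp add: light_like_def)
  \<comment> \<open>Solves \<open>s * (X + 1) / r = \<mu>\<close>, since the two feet add up to
    \<open>((X + 1) / r) *\<^sub>R (m + n)\<close>.\<close>
  define s where "s = \<mu> * r / (X + 1)"
  have "s * X / r + s / r = s * (X + 1) / r"
    by (simp add: add_divide_distrib distrib_left)
  also have "\<dots> = \<mu>"
    using X r by (simp add: s_def)
  finally have "?w = (s * X / r + s / r) *\<^sub>R m + (s * X / r + s / r) *\<^sub>R n"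
    by simp
  also have "\<dots> = s *\<^sub>R foot m n + s *\<^sub>R foot n m"
    by (simp add: f scaleR_add_left scaleR_add_right)
  finally have "?w = s *\<^sub>R foot m n + s *\<^sub>R foot n m" .
  moreover have "s \<ge> 0"
    using \<mu> r X by (simp add: s_def)
  ultimately show "?w \<in> S"
    unfolding S ray_def using wH by blast
qed

text \<open>Minimise over the ray first, with the closed form \<open>sqrt (F w)\<close>, then over
  the compact edge by continuity of \<open>F\<close>. The minimiser is left abstract; its comparison
  property suffices for both bounds.\<close>

lemma transversal_attained:
  assumes m: "m \<bullet>\<^sub>L m = 1" and n: "n \<bullet>\<^sub>L n = 1" and l: "l \<bullet>\<^sub>L l = 1"
    and g: "m \<bullet>\<^sub>L n < -1" "m \<bullet>\<^sub>L l < -1" "n \<bullet>\<^sub>L l < -1"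
    and x: "positive_vec x" "light_like x" "m \<bullet>\<^sub>L x < 0" "n \<bullet>\<^sub>L x < 0" "l \<bullet>\<^sub>L x < 0"
  defines "S \<equiv> segment (foot m n) (foot n m)"
    and "F \<equiv> \<lambda>w. (w \<bullet>\<^sub>L x) / (l \<bullet>\<^sub>L x) * ((w \<bullet>\<^sub>L x) / (l \<bullet>\<^sub>L x) - 2 * (w \<bullet>\<^sub>L l))"
  obtains w where "w \<in> S" "\<And>w'. w' \<in> S \<Longrightarrow> F w \<le> F w'"
    "cosh (shortest_arc_length S (ray (ideal_foot l x) x)) = sqrt (F w)"
proof -
  note seg = segment_between_feet[OF m n g(1) x(1-4), folded S_def]
  have "S \<noteq> {}"
    using seg(4) by blast
  moreover have "continuous_on S F"
    unfolding F_def using x by (intro continuous_intros) auto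
  ultimately obtain w where w: "w \<in> S" and min: "\<And>w'. w' \<in> S \<Longrightarrow> F w \<le> F w'"
    using continuous_attains_inf[OF seg(1), of F] by blast
  \<comment> \<open>The sign needed for the nearest point to fall on the ray; it comes from the
    nonnegative coordinates of \<open>w\<close>.\<close>
  have neg: "w \<bullet>\<^sub>L l \<le> 0" if "w \<in> S" for w
  proof -
    obtain \<sigma> \<tau> where "\<sigma> \<ge> 0" "\<tau> \<ge> 0" "w = \<sigma> *\<^sub>R m + \<tau> *\<^sub>R n"
      using seg(3)[OF \<open>w \<in> S\<close>] by blast
    then show ?thesis
      using g by (simp add: lorentz_simps add_nonpos_nonpos mult_nonneg_nonpos)
  qed
  note ray_min = ray_to_ideal_point_min[OF l x(1,2,5)]
  have H: "w \<in> H3" if "w \<in> S" for w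
    using seg(2) that by blast
  obtain r where r: "r \<in> ray (ideal_foot l x) x" "- (w \<bullet>\<^sub>L r) = sqrt (F w)"
    using ray_min(2)[OF H[OF w] neg[OF w]] unfolding F_def by blast
  have "- (w \<bullet>\<^sub>L r) \<le> - (w' \<bullet>\<^sub>L r')" if "w' \<in> S" "r' \<in> ray (ideal_foot l x) x" for w' r'
  proof -
    have "sqrt (F w) \<le> sqrt (F w')"
      using min[OF that(1)] by simp
    also have "\<dots> \<le> - (w' \<bullet>\<^sub>L r')"
      using ray_min(1)[OF H[OF that(1)] neg[OF that(1)] that(2)] unfolding F_def .
    finally show ?thesis
      using r by simp
  qed
  then have "shortest_arc_length S (ray (ideal_foot l x) x) = arcosh (- (w \<bullet>\<^sub>L r))"
    by (intro shortest_arc_length_eqI w r seg(2)) (auto simp: ray_def)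
  moreover have "- (w \<bullet>\<^sub>L r) \<ge> 1"
    using reverse_Cauchy_Schwarz(1)[OF H[OF w], of r] r(1) by (simp add: ray_def)
  ultimately have "cosh (shortest_arc_length S (ray (ideal_foot l x) x)) = sqrt (F w)"
    using r(2) by simp
  with w min show ?thesis
    by (rule that)
qed

lemma cosh_transversal_ge:
  assumes m: "m \<bullet>\<^sub>L m = 1" and n: "n \<bullet>\<^sub>L n = 1" and l: "l \<bullet>\<^sub>L l = 1"
    and g: "m \<bullet>\<^sub>L n < -1" "m \<bullet>\<^sub>L l < -1" "n \<bullet>\<^sub>L l < -1"
    and z: "positive_vec z" "light_like z" "m \<bullet>\<^sub>L z < 0" "n \<bullet>\<^sub>L z < 0" "l \<bullet>\<^sub>L z < 0"
    and bounds: "L > 0" "H > 0" "- (m \<bullet>\<^sub>L l) \<ge> L" "- (n \<bullet>\<^sub>L l) \<ge> L" "- (m \<bullet>\<^sub>L z) \<ge> H" "- (n \<bullet>\<^sub>L z) \<ge> H"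
    and x: "x = - (m \<bullet>\<^sub>L n)" and y: "y = - (l \<bullet>\<^sub>L z)"
  defines "T \<equiv> shortest_arc_length (segment (foot m n) (foot n m)) (ray (ideal_foot l z) z)"
    and "b \<equiv> sqrt (2 * H / (y * (x - 1)) * (H / y + 2 * L))"
  shows "cosh T \<ge> b"
    and "- (m \<bullet>\<^sub>L l) = L \<Longrightarrow> - (n \<bullet>\<^sub>L l) = L \<Longrightarrow> - (m \<bullet>\<^sub>L z) = H \<Longrightarrow> - (n \<bullet>\<^sub>L z) = H \<Longrightarrow> cosh T = b"
proof -
  define S where "S = segment (foot m n) (foot n m)"
  define F where "F w = (w \<bullet>\<^sub>L z) / (l \<bullet>\<^sub>L z) * ((w \<bullet>\<^sub>L z) / (l \<bullet>\<^sub>L z) - 2 * (w \<bullet>\<^sub>L l))" for w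
  note seg = segment_between_feet[OF m n g(1) z(1-4), folded S_def x]
  obtain w where w: "w \<in> S" "\<And>w'. w' \<in> S \<Longrightarrow> F w \<le> F w'" "cosh T = sqrt (F w)"
    using transversal_attained[OF m n l g z] unfolding S_def F_def T_def by metis
  have xy: "x > 1" "y > 0" "l \<bullet>\<^sub>L z = - y"
    using g z x y by simp_all
  have F: "F (\<sigma> *\<^sub>R m + \<tau> *\<^sub>R n) = (\<sigma> * (- (m \<bullet>\<^sub>L z)) + \<tau> * (- (n \<bullet>\<^sub>L z))) / y
      * ((\<sigma> * (- (m \<bullet>\<^sub>L z)) + \<tau> * (- (n \<bullet>\<^sub>L z))) / y + 2 * (\<sigma> * (- (m \<bullet>\<^sub>L l)) + \<tau> * (- (n \<bullet>\<^sub>L l))))" for \<sigma> \<tau>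
    using xy(2) by (simp add: F_def xy lorentz_simps add_divide_distrib diff_divide_distrib algebra_simps)
  \<comment> \<open>Isolates the scale \<open>2 / (x - 1)\<close>, the lower bound of
    \<open>(\<sigma> + \<tau>)\<^sup>2\<close> and its value at the midpoint.\<close>
  have b: "2 * H / (y * (x - 1)) * (H / y + 2 * L) = 2 / (x - 1) * (H / y * (H / y + 2 * L))"
    using xy by (simp add: field_simps)
  obtain \<sigma> \<tau> where st: "\<sigma> \<ge> 0" "\<tau> \<ge> 0" "w = \<sigma> *\<^sub>R m + \<tau> *\<^sub>R n" "(\<sigma> + \<tau>)\<^sup>2 \<ge> 2 / (x - 1)"
    using seg(3)[OF w(1)] by blast
  define A C where "A = \<sigma> * (- (m \<bullet>\<^sub>L l)) + \<tau> * (- (n \<bullet>\<^sub>L l))"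
    and "C = \<sigma> * (- (m \<bullet>\<^sub>L z)) + \<tau> * (- (n \<bullet>\<^sub>L z))"
  have A: "A \<ge> (\<sigma> + \<tau>) * L" and C: "C \<ge> (\<sigma> + \<tau>) * H"
    unfolding A_def C_def distrib_right using bounds st by (intro add_mono mult_left_mono; simp)+
  have CH: "C / y \<ge> (\<sigma> + \<tau>) * H / y"
    using C xy by (intro divide_right_mono) auto
  have "2 / (x - 1) * (H / y * (H / y + 2 * L)) \<le> (\<sigma> + \<tau>)\<^sup>2 * (H / y * (H / y + 2 * L))"
    using st(4) bounds xy by (intro mult_right_mono) auto
  also have "\<dots> = (\<sigma> + \<tau>) * H / y * ((\<sigma> + \<tau>) * H / y + 2 * ((\<sigma> + \<tau>) * L))"
    by (simp add: power2_eq_square add_divide_distrib algebra_simps)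
  also have "\<dots> \<le> C / y * (C / y + 2 * A)"
    using CH A st bounds xy by (intro mult_mono add_mono) (auto intro: order_trans[rotated])
  also have "\<dots> = F w"
    by (simp add: st(3) F A_def C_def)
  finally show lower: "cosh T \<ge> b"
    unfolding b_def b w(3) by simp
  assume eq: "- (m \<bullet>\<^sub>L l) = L" "- (n \<bullet>\<^sub>L l) = L" "- (m \<bullet>\<^sub>L z) = H" "- (n \<bullet>\<^sub>L z) = H"
  define \<mu> where "\<mu> = sqrt (1 / (2 * (x - 1)))"
  \<comment> \<open>With equal data \<open>F\<close> depends only on \<sigma> + \<tau>, so
    evaluating at the midpoint gives the matching upper bound.\<close>
  have "F w \<le> F (\<mu> *\<^sub>R m + \<mu> *\<^sub>R n)"
    using w(2) seg(4) by (simp add: \<mu>_def)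
  also have "\<dots> = 4 * \<mu>\<^sup>2 * (H / y * (H / y + 2 * L))"
    unfolding F eq by (simp add: power2_eq_square algebra_simps add_divide_distrib)
  also have "4 * \<mu>\<^sup>2 = 2 / (x - 1)"
    using xy by (simp add: \<mu>_def field_simps)
  finally have "cosh T \<le> b"
    unfolding b_def b w(3) by simp
  with lower show "cosh T = b"
    by simp
qed

section \<open>From the data of the tetrahedron to Gram matrix entries\<close>

theorem proposition4p4:
  fixes P :: "nat \<Rightarrow> (real^4) set" and x\<^sub>4 :: "real^4" and \<Delta> :: trunc_tetrahedron
    and i j k :: nat and x y a b c d L H :: real
  assumes planes: "\<And>m. m \<in> {1,2,3} \<Longrightarrow> is_plane (P m)"
    and disjoint: "\<And>m n. m \<in> {1,2,3} \<Longrightarrow> n \<in> {1,2,3} \<Longrightarrow> m \<noteq> n \<Longrightarrow> P m \<inter> P n = {}"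
    and nonparallel:
      "\<And>m n. m \<in> {1,2,3} \<Longrightarrow> n \<in> {1,2,3} \<Longrightarrow> m \<noteq> n \<Longrightarrow> \<not> parallel_planes (P m) (P n)"
    and x4: "positive_vec x\<^sub>4" "light_like x\<^sub>4"
    and x4_not_ideal: "\<And>m. m \<in> {1,2,3} \<Longrightarrow> x\<^sub>4 \<notin> ideal_boundary (P m)"
    and half_spaces: "\<And>m. m \<in> {1,2,3} \<Longrightarrow> \<exists>S. is_face_half_space P x\<^sub>4 m S"
    and Delta: "\<Delta> = trunc_tetrahedron_of P x\<^sub>4"
    and indices: "i \<in> {1,2,3}" "j \<in> {1,2,3}" "i < j" "k \<in> {1,2,3} - {i, j}"
    and x_eq: "x = cosh (edge_length \<Delta> i j)"
    and y_eq: "y = exp (ideal_edge_length \<Delta> k)"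
    and a_eq: "a = cosh (edge_length \<Delta> i k)"
    and b_eq: "b = cosh (edge_length \<Delta> j k)"
    and c_eq: "c = exp (ideal_edge_length \<Delta> i)"
    and d_eq: "d = exp (ideal_edge_length \<Delta> j)"
    and bounds: "L > 1" "H \<ge> 1" "a \<ge> L" "b \<ge> L" "c \<ge> H" "d \<ge> H"
  shows "cosh (transversal_length \<Delta> i j k) \<ge> sqrt (2 * H / (y * (x - 1)) * (H / y + 2 * L)) \<and>
    (a = L \<and> b = L \<and> c = H \<and> d = H \<longrightarrow>
      cosh (transversal_length \<Delta> i j k) = sqrt (2 * H / (y * (x - 1)) * (H / y + 2 * L)))"
proof -
  \<comment> \<open>A unit normal is determined up to sign; since \<open>x\<^sub>4\<close> is not
    ideal for the plane, the sign can be fixed by a negative product with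
    \<open>x\<^sub>4\<close>.\<close>
  have "\<exists>n. n \<bullet>\<^sub>L n = 1 \<and> P m = normal_plane n \<and> n \<bullet>\<^sub>L x\<^sub>4 < 0" if m: "m \<in> {1,2,3}" for m
  proof -
    obtain n where n: "n \<bullet>\<^sub>L n = 1" "P m = normal_plane n"
      using is_plane_imp_normal_plane planes[OF m] by blast
    have "n \<bullet>\<^sub>L x\<^sub>4 \<noteq> 0"
      using x4_not_ideal[OF m] x4 n by (simp add: ideal_boundary_def span_normal_plane)
    then consider "n \<bullet>\<^sub>L x\<^sub>4 < 0" | "(- n) \<bullet>\<^sub>L x\<^sub>4 < 0"
      by (fastforce simp: lorentz_simps)
    then show ?thesis
      using n normal_plane_uminus[of n] by cases (auto simp: lorentz_simps intro: exI[of _ "- n"])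
  qed
  then obtain N where N: "N m \<bullet>\<^sub>L N m = 1" "P m = normal_plane (N m)" "N m \<bullet>\<^sub>L x\<^sub>4 < 0"
    if "m \<in> {1,2,3}" for m
    by metis
  have side: "N m \<bullet>\<^sub>L v < 0" if "m \<in> {1,2,3}" "n \<in> {1,2,3}" "m \<noteq> n" "v \<in> P n" for m n v
  proof -
    obtain S where "is_face_half_space P x\<^sub>4 m S"
      using half_spaces \<open>m \<in> {1,2,3}\<close> by blast
    then show ?thesis
      using face_half_space_side[of P x\<^sub>4 m S "N m" n v] N[OF that(1)] that disjoint[OF that(1-3)] by simp
  qed
  \<comment> \<open>Disjointness and non-parallelism give absolute value above 1; the two side
    conditions select the negative sign.\<close>
  have g: "N m \<bullet>\<^sub>L N n < -1" if mn: "m \<in> {1,2,3}" "n \<in> {1,2,3}" "m \<noteq> n" for m n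
  proof (rule lorentz_normals_less)
    show "(N m \<bullet>\<^sub>L N n)\<^sup>2 > 1"
      using gram_of_disjoint_nonparallel N(1,2) mn disjoint nonparallel by metis
    show "N m \<bullet>\<^sub>L v < 0" if "v \<in> normal_plane (N n)" for v
      using side[OF mn] N(2)[OF mn(2)] that by simp
    show "N n \<bullet>\<^sub>L v < 0" if "v \<in> normal_plane (N m)" for v
      using side[OF mn(2,1)] mn(3) N(2)[OF mn(1)] that by simp
  qed (use N mn in auto)
  have k: "k \<in> {1,2,3}" "i \<noteq> k" "j \<noteq> k" and ij: "i \<noteq> j"
    using indices by auto
  have len: "cosh (edge_length \<Delta> m n) = - (N m \<bullet>\<^sub>L N n)"
    "edge \<Delta> m n = segment (foot (N m) (N n)) (foot (N n) (N m))"
    if mn: "m \<in> {1,2,3}" "n \<in> {1,2,3}" "m \<noteq> n" for m n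
  proof -
    note arc = shortest_arc_normal_planes[OF N(1)[OF mn(1)] N(1)[OF mn(2)] g[OF mn] x4
        N(3)[OF mn(1)] N(3)[OF mn(2)], folded N(2)[OF mn(1)] N(2)[OF mn(2)]]
    show "edge \<Delta> m n = segment (foot (N m) (N n)) (foot (N n) (N m))"
      using arc by (simp add: edge_def Delta trunc_tetrahedron_of_def)
    show "cosh (edge_length \<Delta> m n) = - (N m \<bullet>\<^sub>L N n)"
      using arc g[OF mn] by (simp add: edge_length_def Delta trunc_tetrahedron_of_def)
  qed
  have ideal: "exp (ideal_edge_length \<Delta> m) = - (N m \<bullet>\<^sub>L x\<^sub>4)"
    "ideal_edge \<Delta> m = ray (ideal_foot (N m) x\<^sub>4) x\<^sub>4" if m: "m \<in> {1,2,3}" for m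
    using plane_horoball_dist_normal_plane[OF N(1)[OF m] x4 N(3)[OF m]]
      perp_ray_to_normal_plane[OF N(1)[OF m] x4 N(3)[OF m]] N(2,3)[OF m]
    by (simp_all add: ideal_edge_length_def ideal_edge_def Delta trunc_tetrahedron_of_def)
  have x: "x = - (N i \<bullet>\<^sub>L N j)" and a: "a = - (N i \<bullet>\<^sub>L N k)" and b: "b = - (N j \<bullet>\<^sub>L N k)"
    using len(1) indices(1,2) k ij by (simp_all add: x_eq a_eq b_eq)
  have y: "y = - (N k \<bullet>\<^sub>L x\<^sub>4)" and c: "c = - (N i \<bullet>\<^sub>L x\<^sub>4)" and d: "d = - (N j \<bullet>\<^sub>L x\<^sub>4)"
    using ideal(1) indices(1,2) k by (simp_all add: y_eq c_eq d_eq)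
  have T: "transversal_length \<Delta> i j k = shortest_arc_length
      (segment (foot (N i) (N j)) (foot (N j) (N i))) (ray (ideal_foot (N k) x\<^sub>4) x\<^sub>4)"
    using len(2)[OF indices(1,2) ij] ideal(2)[OF k(1)] by (simp add: transversal_length_def)
  have LH: "L > 0" "H > 0"
    using bounds by simp_all
  note * = cosh_transversal_ge[OF N(1)[OF indices(1)] N(1)[OF indices(2)] N(1)[OF k(1)]
      g[OF indices(1,2) ij] g[OF indices(1) k(1,2)] g[OF indices(2) k(1,3)] x4
      N(3)[OF indices(1)] N(3)[OF indices(2)] N(3)[OF k(1)] LH
      bounds(3-6)[unfolded a b c d] x y, folded T a b c d]
  show ?thesis
    using * by blast
qed

end
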